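(* Let $\lambda_*=\min\{\lambda_1,\dots,\lambda_K\}>0$. For a fluid limit $z$ and $h>0$ let $\tau_h=\inf\{t\ge0:|z(t)|<h\}$. There exist positive constants $b$ and $\varepsilon_0$ such that, for every fluid limit $z$ (almost surely) and any $\varepsilon\in(0,\varepsilon_0)$, $$\min_i z_i(t)\ge b\,\varepsilon\qquad\text{for any } t\in[c\,\varepsilon,\tau_{1-\varepsilon}),\qquad\text{where } c=\frac{1}{K(1-\lambda_* )}.$$
   Context: Model (general, not necessarily symmetric). $\mathcal G=(\mathcal V,\mathcal E)$ is a connected undirected graph with finite vertex set $\mathcal V=\{1,\dots,K\}$. For $i\in\mathcal V$, $V_i=\{i\}\cup\{j\in\mathcal V:(i,j)\in\mathcal E\}$ is the closed neighbourhood of $i$. Time is slotted, $n=0,1,2,\dots$. The arrival vectors $A(n)=(A_1(n),\dots,A_K(n))\in\mathbb N^K$ (with $\mathbb N=\{0,1,2,\dots\}$) form an i.i.d. sequence in $n$ (coordinates may be dependent), with $\mathbf E A_i(n)=\lambda_i\in(0,\infty)$. $W_i(n)$ is the number of users at vertex $i$ at time $n$. Given $W(n)$, the numbers $N_i(n)$ of users attempting transmission are independent over $i$, $N_i(n)$ being binomial with parameters $\bigl(W_i(n),1/\sum_{j\in V_i}W_j(n)\bigr)$ (and $N_i(n)=0$ if $W_i(n)=0$), and $$W_i(n)=W_i(n-1)+A_i(n)-\mathbf 1\{N_i(n-1)=1\}\prod_{j\in V_i\setminus\{i\}}\mathbf 1\{N_j(n-1)=0\}.$$ $W^x$ denotes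 this Markov chain on $\mathbb N^K$ with $W(0)=x$; the chains $W^x$, $x\in\mathbb N^K$, are defined on a common probability space and driven by the same arrivals. Fluid limits. $|x|=\sum_{k=1}^K|x_k|$ for $x\in\mathbb R^K$. For a sequence $x^n\in\mathbb N^K$ with $|x^n|\to\infty$ put $X^n(t)=W^{x^n}(\lceil|x^n|t\rceil)/|x^n|$, $t\ge0$. A fluid limit is any accumulation point $z$, in the Skorokhod topology on $\mathbb R^K$-valued càdlàg functions on $[0,\infty)$, of such a sequence $(X^n)$ (almost surely $(X^n)$ has compact closure). Fluid limits are a.s. Lipschitz continuous, satisfy $|z(0)|=1$ and $z_i(t)\ge0$, and may be random. Convention: $\inf\emptyset=+\infty$.
   Formalization: The formal theorem adds the assumption λ_* < 1; for λ_* = 1 the constant c is undefined, and for λ_* > 1 it is negative, so that the interval contains negative times and t = 0, where the bound fails (e.g. K = 2, z(0) = (1,0)). *)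

theory Defs
  imports "HOL-Probability.Probability"
begin

text \<open>
  A path on \<open>[0,\<infinity>)\<close> is a total function on the reals whose values at negative arguments are
  irrelevant: nothing below inspects them.
\<close>

definition cadlag :: "(real \<Rightarrow> 'a::topological_space) \<Rightarrow> bool" where
  "cadlag z \<longleftrightarrow> (\<forall>t\<ge>0. (z \<longlongrightarrow> z t) (at_right t)) \<and> (\<forall>t>0. \<exists>l. (z \<longlongrightarrow> l) (at_left t))"

definition time_change :: "(real \<Rightarrow> real) \<Rightarrow> bool" where
  "time_change \<mu> \<longleftrightarrow>
     strict_mono_on {0..} \<mu> \<and> continuous_on {0..} \<mu> \<and> \<mu> ` {0..} = {0..}"

text \<open>
  \<open>y \<in> skorokhod_ball z T d\<close>: the suprema of \<open>\<bar>\<mu> s - s\<bar>\<close> over \<open>s \<ge> 0\<close> and of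
  \<open>dist (y (\<mu> s)) (z s)\<close> over \<open>0 \<le> s \<le> T\<close> are both smaller than \<open>d\<close>, for some time change \<open>\<mu>\<close>.
  A sequence is eventually in all of these sets iff there are time changes \<open>\<mu>\<^sub>n\<close> for which the
  first supremum, and the second one for every \<open>T\<close>, tends to 0: the usual description of
  \<open>J\<^sub>1\<close>-convergence on \<open>[0,\<infinity>)\<close>.
\<close>

definition skorokhod_ball ::
    "(real \<Rightarrow> 'a::metric_space) \<Rightarrow> real \<Rightarrow> real \<Rightarrow> (real \<Rightarrow> 'a) set" where
  "skorokhod_ball z T d =
     {y. \<exists>\<mu> e. time_change \<mu> \<and> e < d \<and> (\<forall>s\<ge>0. \<bar>\<mu> s - s\<bar> \<le> e) \<and>
           (\<forall>s\<in>{0..T}. dist (y (\<mu> s)) (z s) \<le> e)}"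

text \<open>
  The topology is introduced on all paths, and the Skorokhod space is its subspace of cadlag
  paths. The reason for the larger space is that the scaled path \<open>t \<mapsto> W \<lceil>r t\<rceil> / r\<close> of a
  discrete time process is left-continuous, hence in general not an element of the Skorokhod
  space, so that no set of cadlag paths would contain it; its limits are required to be cadlag.
\<close>

definition skorokhod :: "(real \<Rightarrow> 'a::metric_space) topology" where
  "skorokhod = topology (\<lambda>U. \<forall>z\<in>U. \<exists>T>0. \<exists>d>0. skorokhod_ball z T d \<subseteq> U)"

lemma skorokhod_ball_mono:
  assumes "T' \<le> T" "d \<le> d'"
  shows "skorokhod_ball z T d \<subseteq> skorokhod_ball z T' d'"
proof
  fix y assume "y \<in> skorokhod_ball z T d"
  then obtain \<mu> e where "time_change \<mu>" "e < d" "\<forall>s\<ge>0. \<bar>\<mu> s - s\<bar> \<le> e"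
      "\<forall>s\<in>{0..T}. dist (y (\<mu> s)) (z s) \<le> e"
    unfolding skorokhod_ball_def by blast
  then show "y \<in> skorokhod_ball z T' d'"
    unfolding skorokhod_ball_def using assms by (intro CollectI exI[of _ \<mu>] exI[of _ e]) auto
qed

lemma openin_skorokhod:
  "openin skorokhod U \<longleftrightarrow> (\<forall>z\<in>U. \<exists>T>0. \<exists>d>0. skorokhod_ball z T d \<subseteq> U)"
proof -
  have "istopology (\<lambda>U :: (real \<Rightarrow> 'a) set. \<forall>z\<in>U. \<exists>T>0. \<exists>d>0. skorokhod_ball z T d \<subseteq> U)"
    unfolding istopology_def
  proof (intro conjI allI impI ballI)
    fix S S' :: "(real \<Rightarrow> 'a) set" and z
    assume S: "\<forall>z\<in>S. \<exists>T>0. \<exists>d>0. skorokhod_ball z T d \<subseteq> S"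
      and S': "\<forall>z\<in>S'. \<exists>T>0. \<exists>d>0. skorokhod_ball z T d \<subseteq> S'" and z: "z \<in> S \<inter> S'"
    obtain T d where 1: "T > 0" "d > 0" "skorokhod_ball z T d \<subseteq> S" using S z by blast
    obtain T' d' where 2: "T' > 0" "d' > 0" "skorokhod_ball z T' d' \<subseteq> S'" using S' z by blast
    have "skorokhod_ball z (max T T') (min d d') \<subseteq> S \<inter> S'"
      using 1 2 skorokhod_ball_mono[of T "max T T'" "min d d'" d z]
        skorokhod_ball_mono[of T' "max T T'" "min d d'" d' z] by auto
    then show "\<exists>T>0. \<exists>d>0. skorokhod_ball z T d \<subseteq> S \<inter> S'"
      using 1 2 by (intro exI[of _ "max T T'"] conjI exI[of _ "min d d'"]) auto
  next
    fix \<K> :: "(real \<Rightarrow> 'a) set set" and z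
    assume "\<forall>K\<in>\<K>. \<forall>z\<in>K. \<exists>T>0. \<exists>d>0. skorokhod_ball z T d \<subseteq> K" "z \<in> \<Union>\<K>"
    then show "\<exists>T>0. \<exists>d>0. skorokhod_ball z T d \<subseteq> \<Union>\<K>"
      by (meson Union_iff Union_upper order_trans)
  qed
  then show ?thesis
    by (simp add: skorokhod_def)
qed

lemma topspace_skorokhod [simp]: "topspace skorokhod = UNIV"
proof -
  have "openin skorokhod (UNIV :: (real \<Rightarrow> 'a) set)"
    unfolding openin_skorokhod by (auto intro: exI[of _ 1])
  then show ?thesis
    using openin_subset by blast
qed

lemma centre_in_skorokhod_ball: "d > 0 \<Longrightarrow> z \<in> skorokhod_ball z T d"
  unfolding skorokhod_ball_def time_change_def
  by (auto intro!: exI[of _ "\<lambda>s. s"] exI[of _ 0] continuous_intros simp: strict_mono_on_def)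

lemma time_change_comp:
  assumes "time_change \<mu>" "time_change \<nu>"
  shows "time_change (\<mu> \<circ> \<nu>)"
proof -
  have \<mu>: "strict_mono_on {0..} \<mu>" "continuous_on {0..} \<mu>" "\<mu> ` {0..} = {0..}"
    and \<nu>: "strict_mono_on {0..} \<nu>" "continuous_on {0..} \<nu>" "\<nu> ` {0..} = {0..}"
    using assms unfolding time_change_def by auto
  have "strict_mono_on {0..} (\<mu> \<circ> \<nu>)"
  proof (rule strict_mono_onI)
    fix r s :: real assume rs: "r \<in> {0..}" "s \<in> {0..}" "r < s"
    then have "\<nu> r \<in> {0..}" "\<nu> s \<in> {0..}" using \<nu>(3) by blast+
    then show "(\<mu> \<circ> \<nu>) r < (\<mu> \<circ> \<nu>) s"
      using strict_mono_onD[OF \<mu>(1)] strict_mono_onD[OF \<nu>(1) rs] by simp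
  qed
  moreover have "continuous_on {0..} (\<mu> \<circ> \<nu>)"
    using \<mu>(2) \<nu>(2,3) by (intro continuous_on_compose) auto
  moreover have "(\<mu> \<circ> \<nu>) ` {0..} = {0..}"
    unfolding image_comp[symmetric] \<nu>(3) \<mu>(3) ..
  ultimately show ?thesis
    unfolding time_change_def by blast
qed

text \<open>The sets \<open>skorokhod_ball z T d\<close> are thus a base of neighbourhoods at \<open>z\<close>.\<close>

lemma openin_skorokhod_ball: "openin skorokhod (skorokhod_ball z T d)"
  unfolding openin_skorokhod
proof
  fix y assume "y \<in> skorokhod_ball z T d"
  then obtain \<mu> e where \<mu>: "time_change \<mu>" "e < d" "\<And>s. s \<ge> 0 \<Longrightarrow> \<bar>\<mu> s - s\<bar> \<le> e"
      "\<And>s. s \<in> {0..T} \<Longrightarrow> dist (y (\<mu> s)) (z s) \<le> e"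
    unfolding skorokhod_ball_def by blast
  have nn: "\<mu> s \<ge> 0" if "s \<ge> 0" for s
    using \<mu>(1) that unfolding time_change_def by fastforce
  define T' where "T' = \<bar>T\<bar> + \<bar>e\<bar> + 1"
  have le: "\<mu> s \<le> T'" if "s \<in> {0..T}" for s
    using \<mu>(3)[of s] that unfolding T'_def by auto
  have "skorokhod_ball y T' (d - e) \<subseteq> skorokhod_ball z T d"
  proof
    fix v assume "v \<in> skorokhod_ball y T' (d - e)"
    then obtain \<nu> e' where \<nu>: "time_change \<nu>" "e' < d - e" "\<And>s. s \<ge> 0 \<Longrightarrow> \<bar>\<nu> s - s\<bar> \<le> e'"
        "\<And>s. s \<in> {0..T'} \<Longrightarrow> dist (v (\<nu> s)) (y s) \<le> e'"
      unfolding skorokhod_ball_def by blast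
    have "\<bar>(\<nu> \<circ> \<mu>) s - s\<bar> \<le> e + e'" if "s \<ge> 0" for s
      using \<mu>(3)[OF that] \<nu>(3)[OF nn[OF that]] by auto
    moreover have "dist (v ((\<nu> \<circ> \<mu>) s)) (z s) \<le> e + e'" if s: "s \<in> {0..T}" for s
    proof -
      have "\<mu> s \<in> {0..T'}" using s nn le by auto
      from \<nu>(4)[OF this] \<mu>(4)[OF s] show ?thesis
        using dist_triangle[of "v (\<nu> (\<mu> s))" "z s" "y (\<mu> s)"] by simp
    qed
    ultimately show "v \<in> skorokhod_ball z T d"
      unfolding skorokhod_ball_def using time_change_comp[OF \<nu>(1) \<mu>(1)] \<nu>(2)
      by (intro CollectI exI[of _ "\<nu> \<circ> \<mu>"] exI[of _ "e + e'"]) auto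
  qed
  moreover have "T' > 0" "d - e > 0" using \<mu>(2) unfolding T'_def by auto
  ultimately show "\<exists>T'>0. \<exists>d'>0. skorokhod_ball y T' d' \<subseteq> skorokhod_ball z T d"
    by blast
qed

definition accumulation_point :: "'a topology \<Rightarrow> (nat \<Rightarrow> 'a) \<Rightarrow> 'a \<Rightarrow> bool" where
  "accumulation_point X f z \<longleftrightarrow>
     z \<in> topspace X \<and> (\<forall>U. openin X U \<and> z \<in> U \<longrightarrow> (\<exists>\<^sub>F n in sequentially. f n \<in> U))"

text \<open>
  The vertex set is the finite type \<open>'v\<close>, so that \<open>K\<close> is \<open>CARD('v)\<close>; edges are pairs in a
  symmetric relation \<open>E\<close>.
\<close>

definition closed_nbhd :: "('v \<times> 'v) set \<Rightarrow> 'v \<Rightarrow> 'v set" where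
  "closed_nbhd E i = {i} \<union> {j. (i, j) \<in> E}"

text \<open>
  The law of the vector of numbers of attempts in state \<open>w\<close>. If \<open>w i = 0\<close> then the \<open>i\<close>-th
  component is 0, also in the case where the division below is by 0.
\<close>

definition attempt_pmf :: "('v::finite \<times> 'v) set \<Rightarrow> ('v \<Rightarrow> nat) \<Rightarrow> ('v \<Rightarrow> nat) pmf" where
  "attempt_pmf E w =
     Pi_pmf UNIV 0 (\<lambda>i. binomial_pmf (w i) (1 / real (\<Sum>j\<in>closed_nbhd E i. w j)))"

definition success :: "('v::finite \<times> 'v) set \<Rightarrow> ('v \<Rightarrow> nat) \<Rightarrow> 'v \<Rightarrow> nat" where
  "success E k i = of_bool (k i = 1) * (\<Prod>j\<in>closed_nbhd E i - {i}. of_bool (k j = 0))"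

text \<open>What has been observed of one chain at time \<open>n\<close>, before the attempts in slot \<open>n\<close>.\<close>

definition history ::
    "(nat \<Rightarrow> 'w \<Rightarrow> 's) \<Rightarrow> (nat \<Rightarrow> 'w \<Rightarrow> 's) \<Rightarrow> (nat \<Rightarrow> 'w \<Rightarrow> 's) \<Rightarrow>
     nat \<Rightarrow> (nat \<Rightarrow> 's) \<Rightarrow> (nat \<Rightarrow> 's) \<Rightarrow> (nat \<Rightarrow> 's) \<Rightarrow> 'w \<Rightarrow> bool" where
  "history A W N n a w k \<omega> \<longleftrightarrow>
     (\<forall>m\<le>n. A m \<omega> = a m \<and> W m \<omega> = w m) \<and> (\<forall>m<n. N m \<omega> = k m)"

text \<open>
  \<open>W x\<close> and \<open>N x\<close> are the queue lengths and attempts of the chain started in \<open>x\<close>. All chains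
  use the same arrivals \<open>A\<close>; the joint law of the attempts of different chains is left open.
  The queue length recursion is stated over the integers and almost surely, because \<open>N \<le> W\<close>
  holds only almost surely. Conditioning is on the whole history (all variables are discrete),
  which is what makes \<open>W x\<close> a Markov chain.
\<close>

locale random_access_network = prob_space M
  for M :: "'w measure" +
  fixes E :: "('v::finite \<times> 'v) set"
    and lam :: "'v \<Rightarrow> real"
    and A :: "nat \<Rightarrow> 'w \<Rightarrow> ('v \<Rightarrow> nat)"
    and W :: "('v \<Rightarrow> nat) \<Rightarrow> nat \<Rightarrow> 'w \<Rightarrow> ('v \<Rightarrow> nat)"
    and N :: "('v \<Rightarrow> nat) \<Rightarrow> nat \<Rightarrow> 'w \<Rightarrow> ('v \<Rightarrow> nat)"
  assumes undirected: "sym E"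
    and connected_graph: "\<And>i j. (i, j) \<in> E\<^sup>*"
    and arrivals_indep: "indep_vars (\<lambda>_. count_space UNIV) A UNIV"
    and arrivals_ident: "\<And>n. distr M (count_space UNIV) (A n) = distr M (count_space UNIV) (A 0)"
    and arrivals_integrable: "\<And>n i. integrable M (\<lambda>\<omega>. real (A n \<omega> i))"
    and arrivals_mean: "\<And>n i. expectation (\<lambda>\<omega>. real (A n \<omega> i)) = lam i"
    and lam_pos: "\<And>i. lam i > 0"
    and W_measurable: "\<And>x n. W x n \<in> measurable M (count_space UNIV)"
    and N_measurable: "\<And>x n. N x n \<in> measurable M (count_space UNIV)"
    and W_0: "\<And>x. AE \<omega> in M. W x 0 \<omega> = x"
    and W_Suc: "\<And>x n. AE \<omega> in M. \<forall>i.
      int (W x (Suc n) \<omega> i) =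
        int (W x n \<omega> i) + int (A (Suc n) \<omega> i) - int (success E (N x n \<omega>) i)"
    and attempts: "\<And>x n a w k.
      \<P>(\<omega> in M. history A (W x) (N x) n a w k \<omega>) > 0 \<Longrightarrow>
      \<P>(\<omega> in M. N x n \<omega> = k n \<bar> history A (W x) (N x) n a w k \<omega>) = pmf (attempt_pmf E (w n)) (k n)"
    and arrivals_fresh: "\<And>x n a w k.
      \<P>(\<omega> in M. A (Suc n) \<omega> = a (Suc n) \<and> history A (W x) (N x) n a w k \<omega> \<and> N x n \<omega> = k n) =
      \<P>(\<omega> in M. A (Suc n) \<omega> = a (Suc n)) *
      \<P>(\<omega> in M. history A (W x) (N x) n a w k \<omega> \<and> N x n \<omega> = k n)"

definition l1_norm :: "real ^ 'v \<Rightarrow> real" where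
  "l1_norm x = (\<Sum>k\<in>UNIV. \<bar>x $ k\<bar>)"

definition real_vec :: "('v::finite \<Rightarrow> nat) \<Rightarrow> real ^ 'v" where
  "real_vec x = (\<chi> i. real (x i))"

definition scaled_path ::
    "(('v::finite \<Rightarrow> nat) \<Rightarrow> nat \<Rightarrow> 'w \<Rightarrow> ('v \<Rightarrow> nat)) \<Rightarrow> 'w \<Rightarrow> ('v \<Rightarrow> nat) \<Rightarrow> real \<Rightarrow> real ^ 'v" where
  "scaled_path W \<omega> x t =
     real_vec (W x (nat \<lceil>l1_norm (real_vec x) * t\<rceil>) \<omega>) /\<^sub>R l1_norm (real_vec x)"

text \<open>
  Fluid limits are taken pathwise: for a fixed sequence \<open>x\<close> of initial states, the accumulation
  points of the scaled paths depend on the sample point \<open>\<omega>\<close>.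
\<close>

definition fluid_limit ::
    "(('v::finite \<Rightarrow> nat) \<Rightarrow> nat \<Rightarrow> 'w \<Rightarrow> ('v \<Rightarrow> nat)) \<Rightarrow> (nat \<Rightarrow> ('v \<Rightarrow> nat)) \<Rightarrow> 'w \<Rightarrow>
     (real \<Rightarrow> real ^ 'v) \<Rightarrow> bool" where
  "fluid_limit W x \<omega> z \<longleftrightarrow>
     filterlim (\<lambda>n. l1_norm (real_vec (x n))) at_top sequentially \<and>
     cadlag z \<and> accumulation_point skorokhod (\<lambda>n. scaled_path W \<omega> (x n)) z"

definition hitting_time :: "(real \<Rightarrow> real ^ 'v) \<Rightarrow> real \<Rightarrow> ereal" where
  "hitting_time z h = (INF t\<in>{t. t \<ge> 0 \<and> l1_norm (z t) < h}. ereal t)"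

end

(*
  A queue i loses at most one user per slot, so a queue that is of the order of the total mass stays
  so for a while. If a queue j has a neighbour of size y, then it succeeds with probability at most
  W_j / y, so it grows at a rate bounded below as long as W_j is small compared with y. Along a path
  of the connected graph this spreads: when the total mass at time s is at least 3/4, all queues at
  time s + h are at least gamma h, for small h and a constant gamma. The theorem follows with
  s = t - c eps and h = c eps.

  All this is done for the discrete chain. The stochastic input is one inequality, obtained from the
  exponential supermartingale exp(excess): the conditional mean of exp(1{success} - A_i) is at most
  exp(2 share - p). It holds up to an error delta r for all initial states of mass r and all but
  finitely many r, by Borel-Cantelli, because there are only polynomially many such states.
*)

theory Submission
  imports Defs
begin

section \<open>Shares within a closed neighbourhood\<close>

text \<open>The mean number of users at \<open>i\<close> that transmit in state \<open>w\<close>,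
  hence a bound for the success probability of \<open>i\<close>. On an empty neighbourhood the
  quotient is 0.\<close>

definition share :: "('v::finite \<times> 'v) set \<Rightarrow> ('v \<Rightarrow> nat) \<Rightarrow> 'v \<Rightarrow> real" where
  "share E w i = real (w i) / real (\<Sum>j\<in>closed_nbhd E i. w j)"

lemma le_sum_closed_nbhd:
  fixes E :: "('v::finite \<times> 'v) set" and w :: "'v \<Rightarrow> nat"
  shows "w i \<le> (\<Sum>j\<in>closed_nbhd E i. w j)"
  by (rule member_le_sum) (auto simp: closed_nbhd_def)

lemma share_le_1: "share E w i \<le> 1"
  using le_sum_closed_nbhd[of w i E] unfolding share_def
  by (metis divide_le_eq_1 of_nat_0_le_iff of_nat_le_iff order_le_less)

text \<open>By symmetry of \<open>E\<close>, the queue \<open>i\<close> is a summand in the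
  denominator of the share of \<open>j\<close>.\<close>

lemma share_ge_imp_ge_neighbour:
  fixes E :: "('v::finite \<times> 'v) set"
  assumes "sym E" "(i, j) \<in> E" "share E w j \<ge> a" "a > 0"
  shows "real (w j) \<ge> a * real (w i)"
proof -
  have "w i \<le> (\<Sum>k\<in>closed_nbhd E j. w k)"
    using assms(1,2) by (intro member_le_sum) (auto simp: closed_nbhd_def dest: symD)
  then have "a * real (w i) \<le> a * real (\<Sum>k\<in>closed_nbhd E j. w k)"
    using assms(4) by (intro mult_left_mono) (simp_all del: of_nat_sum)
  also have "\<dots> \<le> real (w j)"
    using assms(3,4) unfolding share_def
    by (cases "(\<Sum>k\<in>closed_nbhd E j. w k) = 0") (auto simp: field_simps simp del: of_nat_sum)
  finally show ?thesis .
qed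

section \<open>Spreading of mass along edges\<close>

text \<open>A pathwise argument whose only probabilistic input is \<open>drift\<close>, with error
  \<open>D\<close>. At the last slot \<open>v\<close> in which \<open>j\<close> has a share of at
  least \<open>p / 4\<close>, its size is inherited from the neighbour \<open>i\<close>; from then
  on it grows at rate at least \<open>p / 2\<close>, up to a bounded error. Passing one edge thus
  multiplies the slope by \<open>p / 4\<close> and adds \<open>2 * D\<close> to the error.\<close>

lemma growth_step:
  fixes E :: "('v::finite \<times> 'v) set" and w :: "nat \<Rightarrow> 'v \<Rightarrow> nat" and p \<gamma> C D :: real
  assumes E: "sym E" "(i, j) \<in> E"
    and p: "0 < p" "p \<le> 1" and \<gamma>: "0 < \<gamma>" "\<gamma> \<le> 1" and C: "C \<ge> 0" and D: "D \<ge> 2"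
    and drift: "\<And>u v. u \<le> v \<Longrightarrow> v \<le> L \<Longrightarrow>
      real (w v j) \<ge> real (w u j) + p * (real v - real u) - 2 * (\<Sum>k\<in>{u..<v}. share E (w k) j) - D"
    and i: "\<And>u. u \<le> L \<Longrightarrow> real (w u i) \<ge> \<gamma> * real u - C * D"
    and u: "u \<le> L"
  shows "real (w u j) \<ge> (p / 4 * \<gamma>) * real u - (C + 2) * D"
proof -
  \<comment> \<open>The alternative \<open>v = 0\<close> guarantees that a greatest element exists;
    for \<open>v = 0\<close> the bound \<open>at\<close> below has a right-hand side of at most
    0.\<close>
  define P where "P v \<longleftrightarrow> v \<le> u \<and> (v = 0 \<or> share E (w v) j \<ge> p / 4)" for v
  \<comment> \<open>After the last time at which \<open>j\<close> has a share of at least \<open>p / 4\<close>, the drift is at least \<open>p / 2\<close>.\<close>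
  define v where "v = Greatest P"
  have "P 0" by (simp add: P_def)
  then have v: "P v" unfolding v_def by (rule GreatestI_nat[of P 0 u]) (auto simp: P_def)
  have after: "share E (w k) j < p / 4" if "v < k" "k \<le> u" for k
  proof (rule ccontr)
    assume "\<not> ?thesis"
    then have "P k" using that by (auto simp: P_def)
    then have "k \<le> v" unfolding v_def by (rule Greatest_le_nat[of P k u]) (auto simp: P_def)
    with that show False by simp
  qed
  have at: "real (w v j) \<ge> p / 4 * (\<gamma> * real v - C * D)"
  proof (cases "share E (w v) j \<ge> p / 4")
    case True
    have "p / 4 * (\<gamma> * real v - C * D) \<le> p / 4 * real (w v i)"
      using i[of v] v u p by (intro mult_left_mono) (auto simp: P_def)
    also have "\<dots> \<le> real (w v j)"
      using share_ge_imp_ge_neighbour[OF E True] p by simp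
    finally show ?thesis .
  next
    case False
    then have "v = 0" using v by (simp add: P_def)
    moreover have "p / 4 * (C * D) \<ge> 0" using p C D by simp
    ultimately show ?thesis by simp
  qed
  have vu: "v \<le> u" using v by (simp add: P_def)
  \<comment> \<open>In slot \<open>v\<close> itself the share may be as large as 1. This produces
    the 2 in \<open>S\<close>, which is absorbed by \<open>D \<ge> 2\<close> at the end.\<close>
  have "(\<Sum>k\<in>{v..<u}. share E (w k) j) \<le> (\<Sum>k\<in>{v..<u}. p / 4 + (if k = v then 1 else 0))"
  proof (rule sum_mono)
    fix k assume "k \<in> {v..<u}"
    then show "share E (w k) j \<le> p / 4 + (if k = v then 1 else 0)"
      using share_le_1[of E "w k" j] after[of k] p by (cases "k = v") auto
  qed
  also have "\<dots> \<le> p / 4 * (real u - real v) + 1"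
    using vu by (auto simp: sum.distrib sum.delta of_nat_diff)
  finally have S: "2 * (\<Sum>k\<in>{v..<u}. share E (w k) j) \<le> p / 2 * (real u - real v) + 2" by simp
  have "real (w u j) \<ge> p / 4 * (\<gamma> * real v - C * D) + p / 2 * (real u - real v) - 2 - D"
    using drift[OF vu u] S at by argo
  moreover have "p / 2 * (real u - real v) \<ge> p / 4 * \<gamma> * (real u - real v)"
    using p \<gamma> vu by (intro mult_right_mono) (auto simp: mult_le_one)
  moreover have "p / 4 * (C * D) \<le> C * D"
    using p C D by (intro mult_left_le_one_le) auto
  ultimately show ?thesis using D by argo
qed

text \<open>Induction along a path of \<open>d\<close> edges by \<open>growth_step\<close>, starting
  from the queue \<open>i\<close> with slope 1 and error 0.\<close>

lemma growth_relpow: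
  fixes E :: "('v::finite \<times> 'v) set" and w :: "nat \<Rightarrow> 'v \<Rightarrow> nat" and p D :: real
  assumes E: "sym E" and p: "0 < p" "p \<le> 1" and D: "D \<ge> 2"
    and drift: "\<And>u v j. u \<le> v \<Longrightarrow> v \<le> L \<Longrightarrow>
      real (w v j) \<ge> real (w u j) + p * (real v - real u) - 2 * (\<Sum>k\<in>{u..<v}. share E (w k) j) - D"
    and i: "\<And>u. u \<le> L \<Longrightarrow> w u i \<ge> u"
    and "(i, j) \<in> E ^^ d" "u \<le> L"
  shows "real (w u j) \<ge> (p / 4) ^ d * real u - 2 * real d * D"
  using assms(7,8)
proof (induction d arbitrary: j u)
  case 0
  then show ?case using i by simp
next
  case (Suc d)
  then obtain k where k: "(i, k) \<in> E ^^ d" "(k, j) \<in> E" by auto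
  have "real (w u j) \<ge> (p / 4 * (p / 4) ^ d) * real u - (2 * real d + 2) * D"
    using p D Suc.prems(2) Suc.IH[OF k(1)]
    by (intro growth_step[OF E k(2) p _ _ _ D drift]) (auto intro: power_le_one)
  then show ?case by (simp add: algebra_simps)
qed

text \<open>By pigeonhole some queue \<open>i\<close> initially holds at least
  \<open>r / (2 * real CARD('v))\<close> users. Losing at most one per slot, it stays large up to
  time \<open>L\<close>, and a path in the connected graph carries this to \<open>j\<close>.\<close>

lemma growth:
  fixes E :: "('v::finite \<times> 'v) set" and w :: "nat \<Rightarrow> 'v \<Rightarrow> nat" and p D r :: real
  assumes E: "sym E" "\<And>i j. (i, j) \<in> E\<^sup>*" and p: "0 < p" "p \<le> 1" and D: "D \<ge> 2"
    and drift: "\<And>u v j. u \<le> v \<Longrightarrow> v \<le> L \<Longrightarrow>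
      real (w v j) \<ge> real (w u j) + p * (real v - real u) - 2 * (\<Sum>k\<in>{u..<v}. share E (w k) j) - D"
    and dec: "\<And>k i. w k i \<le> w (Suc k) i + 1"
    and start: "real (\<Sum>i\<in>UNIV. w 0 i) \<ge> r / 2" and L: "real L \<le> r / (4 * real CARD('v))"
    and u: "u \<le> L"
  shows "real (w u j) \<ge> (p / 4) ^ card E * real u - 2 * real (card E) * D"
proof -
  have "\<exists>i. real (w 0 i) \<ge> r / (2 * real CARD('v))"
  proof (rule ccontr)
    assume "\<not> ?thesis"
    then have "(\<Sum>i\<in>UNIV. real (w 0 i)) < (\<Sum>i\<in>(UNIV::'v set). r / (2 * real CARD('v)))"
      by (intro sum_strict_mono) (auto simp: not_le)
    then show False using start by simp
  qed
  then obtain i where i: "real (w 0 i) \<ge> r / (2 * real CARD('v))" ..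
  have down: "w 0 i \<le> w k i + k" for k
  proof (induction k)
    case (Suc k)
    then show ?case using dec[of k i] by simp
  qed simp
  \<comment> \<open>The start is at least \<open>2 * L\<close>, so after \<open>k\<close> slots at
    least \<open>2 * L - k\<close> users remain, which is at least \<open>k\<close>.\<close>
  have large: "k \<le> w k i" if "k \<le> L" for k
  proof -
    have "r / (2 * real CARD('v)) = 2 * (r / (4 * real CARD('v)))" by simp
    moreover have "real (w 0 i) \<le> real (w k i) + real k"
      using down[of k] by linarith
    ultimately have "2 * real L \<le> real (w k i) + real k"
      using i L by linarith
    then show ?thesis using that by linarith
  qed
  \<comment> \<open>In a finite relation everything reachable is reached within
    \<open>card E\<close> steps, so slope and error can be chosen independent of \<open>i\<close>
    and \<open>j\<close>.\<close>
  obtain d where d: "d \<le> card E" "(i, j) \<in> E ^^ d"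
    using E(2)[of i j] by (subst (asm) rtrancl_finite_eq_relpow) auto
  have "real (w u j) \<ge> (p / 4) ^ d * real u - 2 * real d * D"
    by (rule growth_relpow[OF E(1) p D drift large d(2) u])
  moreover have "(p / 4) ^ d * real u \<ge> (p / 4) ^ card E * real u"
    using d p by (intro mult_right_mono power_decreasing) auto
  moreover have "2 * real d * D \<le> 2 * real (card E) * D"
    using d D by (intro mult_right_mono) auto
  ultimately show ?thesis by linarith
qed

section \<open>The drift supermartingale\<close>

text \<open>Write \<open>f\<close> as a sum of multiples of point indicators and exchange sum and
  integral.\<close>

lemma nn_integral_countable:
  fixes f :: "'a::countable \<Rightarrow> ennreal"
  assumes "sets \<mu> = UNIV"
  shows "(\<integral>\<^sup>+x. f x \<partial>\<mu>) = (\<integral>\<^sup>+x. f x * emeasure \<mu> {x} \<partial>count_space UNIV)"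
proof -
  have [measurable]: "g \<in> borel_measurable \<mu>" for g :: "'a \<Rightarrow> ennreal"
    using assms by (intro measurableI) auto
  have "(\<integral>\<^sup>+x. f x \<partial>\<mu>) = (\<integral>\<^sup>+x. (\<integral>\<^sup>+y. f y * indicator {y} x \<partial>count_space UNIV) \<partial>\<mu>)"
  proof (rule nn_integral_cong)
    fix x
    have "(\<integral>\<^sup>+y. f y * indicator {y} x \<partial>count_space UNIV) =
        (\<integral>\<^sup>+y. f y * indicator {x} y \<partial>count_space UNIV)"
      by (intro nn_integral_cong) (auto split: split_indicator)
    then show "f x = (\<integral>\<^sup>+y. f y * indicator {y} x \<partial>count_space UNIV)"
      by simp
  qed
  also have "\<dots> = (\<integral>\<^sup>+y. (\<integral>\<^sup>+x. f y * indicator {y} x \<partial>\<mu>) \<partial>count_space UNIV)"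
    by (intro nn_integral_count_space_nn_integral) auto
  also have "\<dots> = (\<integral>\<^sup>+y. f y * emeasure \<mu> {y} \<partial>count_space UNIV)"
    by (intro nn_integral_cong nn_integral_cmult_indicator) (simp add: assms)
  finally show ?thesis .
qed

lemma measurable_Pair_count_space:
  fixes X :: "'w \<Rightarrow> 's::countable" and Y :: "'w \<Rightarrow> 't::countable"
  assumes "X \<in> measurable M (count_space UNIV)" "Y \<in> measurable M (count_space UNIV)"
  shows "(\<lambda>\<omega>. (X \<omega>, Y \<omega>)) \<in> measurable M (count_space UNIV)"
  using measurable_Pair[OF assms] by (simp add: pair_measure_countable)

text \<open>The tower property: \<open>joint\<close> says that \<open>\<kappa>\<close> is a
  conditional law of \<open>Y\<close> given \<open>X\<close>. Its product form avoids dividing by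
  the probability of a null event.\<close>

lemma nn_integral_kernel:
  fixes X :: "'w \<Rightarrow> 's::countable" and Y :: "'w \<Rightarrow> 't::countable" and F :: "'s \<times> 't \<Rightarrow> ennreal"
  assumes [measurable]: "X \<in> measurable M (count_space UNIV)" "Y \<in> measurable M (count_space UNIV)"
    and sets: "\<And>s. sets (\<kappa> s) = UNIV"
    and joint: "\<And>s t. emeasure M {\<omega>\<in>space M. X \<omega> = s \<and> Y \<omega> = t} =
      emeasure M {\<omega>\<in>space M. X \<omega> = s} * emeasure (\<kappa> s) {t}"
  shows "(\<integral>\<^sup>+\<omega>. F (X \<omega>, Y \<omega>) \<partial>M) = (\<integral>\<^sup>+\<omega>. (\<integral>\<^sup>+t. F (X \<omega>, t) \<partial>\<kappa> (X \<omega>)) \<partial>M)"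
proof -
  have XY[measurable]: "(\<lambda>\<omega>. (X \<omega>, Y \<omega>)) \<in> measurable M (count_space UNIV)"
    by (rule measurable_Pair_count_space) measurable
  have law: "emeasure (distr M (count_space UNIV) (\<lambda>\<omega>. (X \<omega>, Y \<omega>))) {(s, t)} =
      emeasure (distr M (count_space UNIV) X) {s} * emeasure (\<kappa> s) {t}" for s t
    using joint[of s t] by (simp add: emeasure_distr vimage_def Int_def conj_ac)
  have "(\<integral>\<^sup>+\<omega>. F (X \<omega>, Y \<omega>) \<partial>M) = (\<integral>\<^sup>+z. F z \<partial>distr M (count_space UNIV) (\<lambda>\<omega>. (X \<omega>, Y \<omega>)))"
    by (simp add: nn_integral_distr)
  also have "\<dots> = (\<integral>\<^sup>+z. F z * emeasure (distr M (count_space UNIV) (\<lambda>\<omega>. (X \<omega>, Y \<omega>))) {z}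
      \<partial>count_space UNIV)"
    by (rule nn_integral_countable) simp
  also have "\<dots> = (\<integral>\<^sup>+s. \<integral>\<^sup>+t. F (s, t) * (emeasure (distr M (count_space UNIV) X) {s} * emeasure (\<kappa> s) {t})
      \<partial>count_space UNIV \<partial>count_space UNIV)"
    by (subst nn_integral_fst_count_space[symmetric]) (simp add: law)
  also have "\<dots> = (\<integral>\<^sup>+s. (\<integral>\<^sup>+t. F (s, t) \<partial>\<kappa> s) * emeasure (distr M (count_space UNIV) X) {s}
      \<partial>count_space UNIV)"
    by (subst nn_integral_countable[OF sets], subst nn_integral_multc[symmetric])
      (auto intro!: nn_integral_cong simp: mult_ac)
  also have "\<dots> = (\<integral>\<^sup>+s. (\<integral>\<^sup>+t. F (s, t) \<partial>\<kappa> s) \<partial>distr M (count_space UNIV) X)"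
    by (rule nn_integral_countable[symmetric]) simp
  also have "\<dots> = (\<integral>\<^sup>+\<omega>. (\<integral>\<^sup>+t. F (X \<omega>, t) \<partial>\<kappa> (X \<omega>)) \<partial>M)"
    by (simp add: nn_integral_distr)
  finally show ?thesis .
qed

section \<open>Estimates for a single slot\<close>

lemma success_le: "success E k i \<le> of_bool (k i = 1)"
proof -
  have "(\<Prod>j\<in>closed_nbhd E i - {i}. of_bool (k j = 0) :: nat) \<le> 1"
    by (intro prod_le_1) auto
  then show ?thesis by (simp add: success_def)
qed

text \<open>A success requires that exactly one user at \<open>i\<close> transmits, which has
  probability at most the mean \<open>share E w i\<close>. The factor 2 comes from
  \<open>exp 1 \<le> 3\<close>, and \<open>1 + x \<le> exp x\<close> gives the exponential
  form.\<close>

lemma nn_integral_attempt_pmf: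
  fixes E :: "('v::finite \<times> 'v) set"
  shows "(\<integral>\<^sup>+k. ennreal (exp (real (success E k i))) \<partial>attempt_pmf E w) \<le> ennreal (exp (2 * share E w i))"
proof -
  define S where "S = (\<Sum>j\<in>closed_nbhd E i. w j)"
  define B where "B = binomial_pmf (w i) (1 / real S)"
  have marginal: "map_pmf (\<lambda>k. k i) (attempt_pmf E w) = B"
    unfolding attempt_pmf_def B_def S_def by (subst Pi_pmf_component) auto
  have prob: "1 / real S \<in> {0..1}"
    by (cases "S = 0") (auto simp: divide_simps)
  \<comment> \<open>The binomial weight at 1 is \<open>w i * q * (1 - q) ^ (w i - 1)\<close> with
    \<open>q = 1 / S\<close>; for \<open>w i = 0\<close> the truncated exponent is harmless because
    of the first factor.\<close>
  have "(1 - 1 / real S) ^ (w i - 1) \<le> 1"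
    using prob by (intro power_le_one) auto
  then have "real (w i) / real S * (1 - 1 / real S) ^ (w i - 1) \<le> real (w i) / real S"
    by (intro mult_right_le_one_le) (use prob in auto)
  then have one: "pmf B 1 \<le> share E w i"
    using prob unfolding B_def share_def S_def[symmetric] by (simp add: mult.assoc)
  have "(\<integral>\<^sup>+k. ennreal (exp (real (success E k i))) \<partial>attempt_pmf E w) \<le>
      (\<integral>\<^sup>+k. 1 + 2 * indicator {1} (k i) \<partial>attempt_pmf E w)"
  proof (rule nn_integral_mono)
    fix k
    have "real (success E k i) \<le> indicator {1} (k i)"
      using success_le[of E k i] by (auto split: split_indicator)
    then have "exp (real (success E k i)) \<le> exp (indicator {1} (k i))" by simp
    also have "\<dots> \<le> 1 + 2 * indicator {1} (k i)"
      using exp_le by (auto split: split_indicator)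
    finally have "ennreal (exp (real (success E k i))) \<le> ennreal (1 + 2 * indicator {1} (k i))"
      by (rule ennreal_leI)
    also have "\<dots> = 1 + 2 * indicator {1} (k i)" by (auto split: split_indicator)
    finally show "ennreal (exp (real (success E k i))) \<le> 1 + 2 * indicator {1} (k i)" .
  qed
  also have "\<dots> = (\<integral>\<^sup>+y. 1 + 2 * indicator {1} y \<partial>B)"
    by (simp add: marginal[symmetric])
  also have "\<dots> = 1 + 2 * ennreal (pmf B 1)"
    by (simp add: nn_integral_add nn_integral_cmult emeasure_pmf_single)
  also have "\<dots> = ennreal (1 + 2 * pmf B 1)"
    by (simp add: ennreal_plus ennreal_mult)
  also have "\<dots> \<le> ennreal (exp (2 * share E w i))"
    using one exp_ge_add_one_self[of "2 * share E w i"] by (intro ennreal_leI) linarith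
  finally show ?thesis .
qed

text \<open>The amount by which the growth \<open>w n i - w m i\<close> falls short of its lower drift bound.\<close>

definition excess :: "('v::finite \<times> 'v) set \<Rightarrow> real \<Rightarrow> (nat \<Rightarrow> 'v \<Rightarrow> nat) \<Rightarrow> 'v \<Rightarrow> nat \<Rightarrow> nat \<Rightarrow> real" where
  "excess E p w i m n =
     p * (real n - real m) + real (w m i) - real (w n i) - 2 * (\<Sum>k\<in>{m..<n}. share E (w k) i)"

section \<open>Polynomial counts against exponential decay\<close>

text \<open>Half of the decay rate beats the polynomial, since
  \<open>y ^ k \<le> fact k * exp y\<close>; the other half leaves a geometric series.\<close>

lemma summable_poly_exp:
  fixes \<delta> :: real
  assumes "\<delta> > 0"
  shows "summable (\<lambda>r. (real r + 1) ^ k * exp (- \<delta> * real r))"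
proof (rule summable_comparison_test')
  show "summable (\<lambda>r. (fact k * (2 / \<delta>) ^ k * exp (\<delta> / 2)) * exp (- \<delta> / 2) ^ r)"
    using assms by (intro summable_mult summable_geometric) auto
next
  fix r :: nat
  define y where "y = \<delta> / 2 * (real r + 1)"
  have y: "y \<ge> 0" using assms by (simp add: y_def)
  have "inverse (fact k) *\<^sub>R y ^ k \<le> (\<Sum>n. inverse (fact n) *\<^sub>R y ^ n)"
    using sum_le_suminf[OF summable_exp_generic[of y], of "{k}"] y by auto
  then have "y ^ k \<le> fact k * exp y"
    by (simp add: exp_def field_simps)
  moreover have "real r + 1 = 2 / \<delta> * y"
    using assms by (simp add: y_def)
  then have "(real r + 1) ^ k = (2 / \<delta>) ^ k * y ^ k"
    by (simp only: power_mult_distrib)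
  ultimately have "(real r + 1) ^ k \<le> (2 / \<delta>) ^ k * (fact k * exp y)"
    using assms by (simp add: mult_left_mono)
  then have "(real r + 1) ^ k * exp (- \<delta> * real r) \<le> (2 / \<delta>) ^ k * (fact k * exp y) * exp (- \<delta> * real r)"
    by (intro mult_right_mono) auto
  also have "\<dots> = (2 / \<delta>) ^ k * fact k * exp (y - \<delta> * real r)"
    by (simp add: exp_diff exp_minus field_simps)
  also have "y - \<delta> * real r = \<delta> / 2 + real r * (- \<delta> / 2)"
    by (simp add: y_def field_simps)
  also have "exp (\<delta> / 2 + real r * (- \<delta> / 2)) = exp (\<delta> / 2) * exp (- \<delta> / 2) ^ r"
    by (simp only: exp_add exp_of_nat_mult)
  finally show "norm ((real r + 1) ^ k * exp (- \<delta> * real r)) \<le>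
      (fact k * (2 / \<delta>) ^ k * exp (\<delta> / 2)) * exp (- \<delta> / 2) ^ r"
    by (simp add: mult_ac)
qed

lemma card_states_le:
  "finite {x :: 'v::finite \<Rightarrow> nat. sum x UNIV = r}"
  "card {x :: 'v::finite \<Rightarrow> nat. sum x UNIV = r} \<le> (r + 1) ^ CARD('v)"
proof -
  have sub: "{x :: 'v \<Rightarrow> nat. sum x UNIV = r} \<subseteq> PiE UNIV (\<lambda>_. {..r})"
    by (auto simp: PiE_def member_le_sum)
  have fin: "finite (PiE (UNIV :: 'v set) (\<lambda>_. {..r}))"
    by (intro finite_PiE) auto
  show "finite {x :: 'v \<Rightarrow> nat. sum x UNIV = r}"
    using finite_subset[OF sub fin] .
  show "card {x :: 'v \<Rightarrow> nat. sum x UNIV = r} \<le> (r + 1) ^ CARD('v)"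
    using card_mono[OF fin sub] by (simp add: card_PiE)
qed

section \<open>Conditioning on the history of one chain\<close>

context random_access_network
begin

lemma A_measurable [measurable]: "A n \<in> measurable M (count_space UNIV)"
  using arrivals_indep by (auto simp: indep_vars_def)

declare W_measurable [measurable] N_measurable [measurable]

text \<open>The data of \<open>history\<close> as one random variable with values in a countable
  type, so that \<open>nn_integral_kernel\<close> applies. The transmissions in slot
  \<open>n\<close> itself are left out.\<close>

definition trace ::
    "('v \<Rightarrow> nat) \<Rightarrow> nat \<Rightarrow> 'w \<Rightarrow> ('v \<Rightarrow> nat) list \<times> ('v \<Rightarrow> nat) list \<times> ('v \<Rightarrow> nat) list" where
  "trace x n \<omega> = (map (\<lambda>k. A k \<omega>) [0..<Suc n], map (\<lambda>k. W x k \<omega>) [0..<Suc n], map (\<lambda>k. N x k \<omega>) [0..<n])"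

lemma trace_eq_iff:
  "trace x n \<omega> = (la, lw, lk) \<longleftrightarrow> length la = Suc n \<and> length lw = Suc n \<and> length lk = n \<and>
     history A (W x) (N x) n ((!) la) ((!) lw) ((!) lk) \<omega>"
  unfolding trace_def history_def list_eq_iff_nth_eq prod.inject
  by (auto simp: less_Suc_eq_le simp del: upt_Suc)

lemma sets_history [measurable]: "{\<omega>\<in>space M. history A (W x) (N x) n a w k \<omega>} \<in> sets M"
  unfolding history_def by measurable

lemma trace_measurable [measurable]: "trace x n \<in> measurable M (count_space UNIV)"
proof (subst measurable_count_space_eq2_countable, intro conjI ballI)
  fix \<rho> :: "('v \<Rightarrow> nat) list \<times> ('v \<Rightarrow> nat) list \<times> ('v \<Rightarrow> nat) list"
  obtain la lw lk where \<rho>: "\<rho> = (la, lw, lk)" by (cases \<rho>)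
  have "trace x n -` {\<rho>} \<inter> space M = {\<omega>\<in>space M. trace x n \<omega> = \<rho>}" by auto
  also have "\<dots> \<in> sets M" unfolding \<rho> trace_eq_iff by measurable
  finally show "trace x n -` {\<rho>} \<inter> space M \<in> sets M" .
qed auto

text \<open>This turns \<open>attempts\<close>, a statement about conditional probabilities of
  single events, into the tower property given the whole history.\<close>

lemma nn_integral_attempts:
  "(\<integral>\<^sup>+\<omega>. F (trace x n \<omega>, N x n \<omega>) \<partial>M) =
   (\<integral>\<^sup>+\<omega>. (\<integral>\<^sup>+k. F (trace x n \<omega>, k) \<partial>attempt_pmf E (W x n \<omega>)) \<partial>M)"
proof -
  define \<kappa> where "\<kappa> \<rho> = measure_pmf (attempt_pmf E (fst (snd \<rho>) ! n))"
    for \<rho> :: "('v \<Rightarrow> nat) list \<times> ('v \<Rightarrow> nat) list \<times> ('v \<Rightarrow> nat) list"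
  have \<kappa>: "\<kappa> (trace x n \<omega>) = measure_pmf (attempt_pmf E (W x n \<omega>))" for \<omega>
    by (simp add: \<kappa>_def trace_def del: upt_Suc)
  have "(\<integral>\<^sup>+\<omega>. F (trace x n \<omega>, N x n \<omega>) \<partial>M) = (\<integral>\<^sup>+\<omega>. (\<integral>\<^sup>+k. F (trace x n \<omega>, k) \<partial>\<kappa> (trace x n \<omega>)) \<partial>M)"
  proof (rule nn_integral_kernel)
    fix \<rho> :: "('v \<Rightarrow> nat) list \<times> ('v \<Rightarrow> nat) list \<times> ('v \<Rightarrow> nat) list" and k :: "'v \<Rightarrow> nat"
    obtain la lw lk where \<rho>: "\<rho> = (la, lw, lk)" by (cases \<rho>)
    show "emeasure M {\<omega>\<in>space M. trace x n \<omega> = \<rho> \<and> N x n \<omega> = k} =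
        emeasure M {\<omega>\<in>space M. trace x n \<omega> = \<rho>} * emeasure (\<kappa> \<rho>) {k}"
    proof (cases "length la = Suc n \<and> length lw = Suc n \<and> length lk = n")
      case False
      then have "trace x n \<omega> \<noteq> \<rho>" for \<omega> unfolding \<rho> trace_eq_iff by blast
      then show ?thesis by simp
    next
      case True
      \<comment> \<open>\<open>attempts\<close> reads the value for slot \<open>n\<close> from entry
        \<open>n\<close> of its sequence, whereas \<open>history\<close> inspects only the entries
        below \<open>n\<close>; overriding that entry leaves the event unchanged.\<close>
      define h where "h = ((!) lk)(n := k)"
      have hist: "trace x n \<omega> = \<rho> \<longleftrightarrow> history A (W x) (N x) n ((!) la) ((!) lw) h \<omega>" for \<omega>
        using True unfolding \<rho> trace_eq_iff by (auto simp: history_def h_def)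
      have "\<P>(\<omega> in M. N x n \<omega> = k \<and> trace x n \<omega> = \<rho>) =
          \<P>(\<omega> in M. trace x n \<omega> = \<rho>) * pmf (attempt_pmf E (lw ! n)) k"
      \<comment> \<open>\<open>attempts\<close> says nothing about null histories; for these both
        sides vanish.\<close>
      proof (cases "\<P>(\<omega> in M. trace x n \<omega> = \<rho>) = 0")
        case True
        moreover have "\<P>(\<omega> in M. N x n \<omega> = k \<and> trace x n \<omega> = \<rho>) \<le> \<P>(\<omega> in M. trace x n \<omega> = \<rho>)"
          by (intro finite_measure_mono) auto
        ultimately show ?thesis
          by (simp add: measure_le_0_iff)
      next
        case False
        then have "\<P>(\<omega> in M. history A (W x) (N x) n ((!) la) ((!) lw) h \<omega>) > 0"
          unfolding hist by (simp add: zero_less_measure_iff)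
        from attempts[OF this] False show ?thesis
          by (simp add: cond_prob_def hist h_def field_simps)
      qed
      then show ?thesis
        by (simp add: emeasure_eq_measure emeasure_pmf_single \<kappa>_def \<rho> ennreal_mult conj_commute)
    qed
  qed (auto simp: \<kappa>_def)
  then show ?thesis unfolding \<kappa> .
qed

text \<open>The next arrivals are independent of the history and of the current transmissions and
  have the law of \<open>A 0\<close>; \<open>\<omega>'\<close> plays the part of an independent
  copy.\<close>

lemma nn_integral_arrivals:
  "(\<integral>\<^sup>+\<omega>. F ((trace x n \<omega>, N x n \<omega>), A (Suc n) \<omega>) \<partial>M) =
   (\<integral>\<^sup>+\<omega>. (\<integral>\<^sup>+\<omega>'. F ((trace x n \<omega>, N x n \<omega>), A 0 \<omega>') \<partial>M) \<partial>M)"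
proof -
  have pair [measurable]: "(\<lambda>\<omega>. (trace x n \<omega>, N x n \<omega>)) \<in> measurable M (count_space UNIV)"
    by (rule measurable_Pair_count_space) measurable
  have "(\<integral>\<^sup>+\<omega>. F ((trace x n \<omega>, N x n \<omega>), A (Suc n) \<omega>) \<partial>M) =
      (\<integral>\<^sup>+\<omega>. (\<integral>\<^sup>+a. F ((trace x n \<omega>, N x n \<omega>), a) \<partial>distr M (count_space UNIV) (A 0)) \<partial>M)"
  proof (rule nn_integral_kernel)
    fix \<sigma> :: "(('v \<Rightarrow> nat) list \<times> ('v \<Rightarrow> nat) list \<times> ('v \<Rightarrow> nat) list) \<times> ('v \<Rightarrow> nat)"
      and a :: "'v \<Rightarrow> nat"
    obtain la lw lk k where \<sigma>: "\<sigma> = ((la, lw, lk), k)" by (metis surj_pair)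
    show "emeasure M {\<omega>\<in>space M. (trace x n \<omega>, N x n \<omega>) = \<sigma> \<and> A (Suc n) \<omega> = a} =
        emeasure M {\<omega>\<in>space M. (trace x n \<omega>, N x n \<omega>) = \<sigma>} *
        emeasure (distr M (count_space UNIV) (A 0)) {a}"
    proof (cases "length la = Suc n \<and> length lw = Suc n \<and> length lk = n")
      case False
      then have "trace x n \<omega> \<noteq> (la, lw, lk)" for \<omega> unfolding trace_eq_iff by blast
      then show ?thesis by (simp add: \<sigma>)
    next
      case True
      define h where "h = ((!) lk)(n := k)"
      \<comment> \<open>As for \<open>h\<close>: \<open>history\<close> at time \<open>n\<close>
        does not inspect entry \<open>Suc n\<close>.\<close>
      define g where "g = ((!) la)(Suc n := a)"
      have hist: "(trace x n \<omega>, N x n \<omega>) = \<sigma> \<longleftrightarrow>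
          history A (W x) (N x) n g ((!) lw) h \<omega> \<and> N x n \<omega> = h n" for \<omega>
        using True unfolding \<sigma> prod.inject trace_eq_iff by (auto simp: history_def h_def g_def)
      have "emeasure (distr M (count_space UNIV) (A 0)) {a} =
          emeasure (distr M (count_space UNIV) (A (Suc n))) {a}"
        by (simp only: arrivals_ident[of "Suc n"])
      also have "\<dots> = ennreal (\<P>(\<omega> in M. A (Suc n) \<omega> = g (Suc n)))"
        by (simp add: emeasure_distr emeasure_eq_measure g_def vimage_def Int_def conj_commute)
      finally have "emeasure (distr M (count_space UNIV) (A 0)) {a} = \<dots>" .
      moreover have "{\<omega>\<in>space M. (trace x n \<omega>, N x n \<omega>) = \<sigma> \<and> A (Suc n) \<omega> = a} =
          {\<omega>\<in>space M. A (Suc n) \<omega> = g (Suc n) \<and> history A (W x) (N x) n g ((!) lw) h \<omega> \<and> N x n \<omega> = h n}"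
        unfolding hist by (auto simp: g_def)
      ultimately show ?thesis
        using arrivals_fresh[of n g x "(!) lw" h]
        by (simp add: emeasure_eq_measure hist ennreal_mult mult.commute)
    qed
  qed auto
  then show ?thesis by (simp add: nn_integral_distr)
qed

section \<open>The exponential supermartingale\<close>

text \<open>A positive mean prevents \<open>A 0 \<omega> i\<close> from vanishing almost surely, so
  its Laplace transform at 1 is below 1. There are finitely many vertices, hence a common
  \<open>p\<close>.\<close>

lemma arrival_rate:
  "\<exists>p>0. p \<le> 1 \<and> (\<forall>i. (\<integral>\<^sup>+\<omega>. ennreal (exp (- real (A 0 \<omega> i))) \<partial>M) \<le> ennreal (exp (- p)))"
proof -
  define \<theta> where "\<theta> i = expectation (\<lambda>\<omega>. exp (- real (A 0 \<omega> i)))" for i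
  have [measurable]: "(\<lambda>\<omega>. real (A 0 \<omega> i)) \<in> borel_measurable M" for i
    by (rule borel_measurable_integrable[OF arrivals_integrable])
  have int: "integrable M (\<lambda>\<omega>. exp (- real (A 0 \<omega> i)))" for i
    by (rule integrable_const_bound[of _ 1]) auto
  have nn: "(\<integral>\<^sup>+\<omega>. ennreal (exp (- real (A 0 \<omega> i))) \<partial>M) = ennreal (\<theta> i)" for i
    unfolding \<theta>_def by (intro nn_integral_eq_integral int) auto
  have less: "\<theta> i < 1" for i
  proof (rule ccontr)
    assume "\<not> \<theta> i < 1"
    moreover have "\<theta> i \<le> expectation (\<lambda>_. 1)"
      unfolding \<theta>_def by (intro integral_mono int) auto
    ultimately have "expectation (\<lambda>\<omega>. 1 - exp (- real (A 0 \<omega> i))) = 0"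
      using int[of i] by (simp add: \<theta>_def prob_space)
    then have "AE \<omega> in M. 1 - exp (- real (A 0 \<omega> i)) = 0"
      by (subst (asm) integral_nonneg_eq_0_iff_AE) (auto simp: int)
    then have "expectation (\<lambda>\<omega>. real (A 0 \<omega> i)) = expectation (\<lambda>_. 0)"
      by (intro integral_cong_AE) auto
    then show False
      using arrivals_mean[of 0 i] lam_pos[of i] by simp
  qed
  \<comment> \<open>The cut-off at \<open>exp (- 1)\<close> yields \<open>- ln q \<le> 1\<close>,
    the bound \<open>p \<le> 1\<close> used in the growth lemmas.\<close>
  define q where "q = max (exp (- 1)) (MAX i. \<theta> i)"
  have q: "0 < q" "q < 1" "exp (- 1) \<le> q" "\<theta> i \<le> q" for i
    using less by (auto simp: q_def less_max_iff_disj le_max_iff_disj)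
  have "- ln q \<le> 1"
    using q(1,3) by (metis ln_exp ln_le_cancel_iff exp_gt_zero minus_le_iff)
  then show ?thesis
    using q by (intro exI[of _ "- ln q"]) (auto simp: nn intro: ennreal_leI)
qed

text \<open>In one slot \<open>excess\<close> changes by \<open>p - 2 * share + success - A\<close>.
  Integrating out the arrivals gives a factor of at most \<open>exp (- p)\<close>, then the
  transmissions one of at most \<open>exp (2 * share)\<close>, and everything cancels.\<close>

lemma nn_integral_exp_excess:
  assumes p: "\<And>i. (\<integral>\<^sup>+\<omega>. ennreal (exp (- real (A 0 \<omega> i))) \<partial>M) \<le> ennreal (exp (- p))"
    and "m \<le> n"
  shows "(\<integral>\<^sup>+\<omega>. ennreal (exp (excess E p (\<lambda>k. W x k \<omega>) i m n)) \<partial>M) \<le> 1"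
  using assms(2)
proof (induction n rule: dec_induct)
  case base
  then show ?case by (simp add: excess_def emeasure_space_1)
next
  case (step n)
  \<comment> \<open>The exponential is split by what it depends on: \<open>g\<close> on the trace
    only, \<open>G\<close> also on the transmissions in slot \<open>n\<close>, \<open>F\<close> also
    on the arrivals that follow.\<close>
  define g where "g \<rho> = ennreal (exp (excess E p ((!) (fst (snd \<rho>))) i m n)) *
      ennreal (exp (p - 2 * share E (fst (snd \<rho>) ! n) i))"
    for \<rho> :: "('v \<Rightarrow> nat) list \<times> ('v \<Rightarrow> nat) list \<times> ('v \<Rightarrow> nat) list"
  define G where "G = (\<lambda>(\<rho>, k). g \<rho> * ennreal (exp (real (success E k i))))"
  define F where "F = (\<lambda>(\<sigma>, a :: 'v \<Rightarrow> nat). G \<sigma> * ennreal (exp (- real (a i))))"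
  have [measurable]: "(\<lambda>\<omega>. real (A 0 \<omega> i)) \<in> borel_measurable M"
    by (rule borel_measurable_integrable[OF arrivals_integrable])
  have nth: "fst (snd (trace x n \<omega>)) ! k = W x k \<omega>" if "k \<le> n" for k \<omega>
    using that by (simp add: trace_def less_Suc_eq_le del: upt_Suc)
  have g: "g (trace x n \<omega>) = ennreal (exp (excess E p (\<lambda>k. W x k \<omega>) i m n)) *
      ennreal (exp (p - 2 * share E (W x n \<omega>) i))" for \<omega>
    using step(1) by (simp add: g_def excess_def nth)
  have "AE \<omega> in M. ennreal (exp (excess E p (\<lambda>k. W x k \<omega>) i m (Suc n))) =
      F ((trace x n \<omega>, N x n \<omega>), A (Suc n) \<omega>)"
    using W_Suc[of x n]
  proof eventually_elim
    case (elim \<omega>)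
    then have "real (W x (Suc n) \<omega> i) =
        real (W x n \<omega> i) + real (A (Suc n) \<omega> i) - real (success E (N x n \<omega>) i)"
      by (metis of_int_add of_int_diff of_int_of_nat_eq)
    then have "excess E p (\<lambda>k. W x k \<omega>) i m (Suc n) = excess E p (\<lambda>k. W x k \<omega>) i m n +
        (p - 2 * share E (W x n \<omega>) i) + real (success E (N x n \<omega>) i) + - real (A (Suc n) \<omega> i)"
      using step(1) by (simp add: excess_def algebra_simps)
    then show ?case
      by (simp only: F_def G_def g case_prod_conv exp_add) (simp add: ennreal_mult)
  qed
  then have "(\<integral>\<^sup>+\<omega>. ennreal (exp (excess E p (\<lambda>k. W x k \<omega>) i m (Suc n))) \<partial>M) =
      (\<integral>\<^sup>+\<omega>. F ((trace x n \<omega>, N x n \<omega>), A (Suc n) \<omega>) \<partial>M)"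
    by (rule nn_integral_cong_AE)
  also have "\<dots> = (\<integral>\<^sup>+\<omega>. (\<integral>\<^sup>+\<omega>'. F ((trace x n \<omega>, N x n \<omega>), A 0 \<omega>') \<partial>M) \<partial>M)"
    by (rule nn_integral_arrivals)
  also have "\<dots> \<le> (\<integral>\<^sup>+\<omega>. G (trace x n \<omega>, N x n \<omega>) * ennreal (exp (- p)) \<partial>M)"
    by (intro nn_integral_mono) (auto simp: F_def nn_integral_cmult intro!: mult_left_mono p)
  also have "\<dots> = (\<integral>\<^sup>+\<omega>. (\<integral>\<^sup>+k. G (trace x n \<omega>, k) * ennreal (exp (- p)) \<partial>attempt_pmf E (W x n \<omega>)) \<partial>M)"
    by (rule nn_integral_attempts[of "\<lambda>\<sigma>. G \<sigma> * ennreal (exp (- p))"])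
  also have "\<dots> \<le> (\<integral>\<^sup>+\<omega>. ennreal (exp (excess E p (\<lambda>k. W x k \<omega>) i m n)) \<partial>M)"
  proof (rule nn_integral_mono)
    fix \<omega>
    let ?e = "ennreal (exp (excess E p (\<lambda>k. W x k \<omega>) i m n))"
    have "(\<integral>\<^sup>+k. G (trace x n \<omega>, k) * ennreal (exp (- p)) \<partial>attempt_pmf E (W x n \<omega>)) =
        g (trace x n \<omega>) * (\<integral>\<^sup>+k. ennreal (exp (real (success E k i))) \<partial>attempt_pmf E (W x n \<omega>)) *
        ennreal (exp (- p))"
      by (simp add: G_def nn_integral_cmult nn_integral_multc)
    also have "\<dots> \<le> g (trace x n \<omega>) * ennreal (exp (2 * share E (W x n \<omega>) i)) * ennreal (exp (- p))"
      by (intro mult_left_mono mult_right_mono nn_integral_attempt_pmf) auto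
    also have "\<dots> = ?e * ennreal (exp (p - 2 * share E (W x n \<omega>) i) *
        exp (2 * share E (W x n \<omega>) i) * exp (- p))"
      by (simp add: g ennreal_mult mult_ac)
    also have "\<dots> = ?e"
      by (simp flip: exp_add)
    finally show "(\<integral>\<^sup>+k. G (trace x n \<omega>, k) * ennreal (exp (- p)) \<partial>attempt_pmf E (W x n \<omega>)) \<le> ?e" .
  qed
  also note step.IH
  finally show ?case .
qed

lemma excess_measurable [measurable]:
  "(\<lambda>\<omega>. excess E p (\<lambda>k. W x k \<omega>) i m n) \<in> borel_measurable M"
proof -
  have W: "(\<lambda>\<omega>. h (W x k \<omega>)) \<in> borel_measurable M" for h :: "('v \<Rightarrow> nat) \<Rightarrow> real" and k
    by (rule measurable_compose[OF W_measurable]) simp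
  note [measurable] = W[of "\<lambda>w. real (w i)"] W[of "\<lambda>w. share E w i"]
  show ?thesis unfolding excess_def by measurable
qed

text \<open>Markov's inequality for the exponential of \<open>excess\<close>.\<close>

lemma prob_excess:
  assumes p: "\<And>i. (\<integral>\<^sup>+\<omega>. ennreal (exp (- real (A 0 \<omega> i))) \<partial>M) \<le> ennreal (exp (- p))"
    and "m \<le> n"
  shows "\<P>(\<omega> in M. excess E p (\<lambda>k. W x k \<omega>) i m n \<ge> a) \<le> exp (- a)"
proof -
  have "emeasure M {\<omega>\<in>space M. excess E p (\<lambda>k. W x k \<omega>) i m n \<ge> a} \<le>
      ennreal (exp (- 1 * a)) *
      (\<integral>\<^sup>+\<omega>. ennreal (exp (1 * excess E p (\<lambda>k. W x k \<omega>) i m n)) * indicator (space M) \<omega> \<partial>M)"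
    by (rule Chernoff_ineq_nn_integral_ge) auto
  also have "\<dots> = ennreal (exp (- a)) * (\<integral>\<^sup>+\<omega>. ennreal (exp (excess E p (\<lambda>k. W x k \<omega>) i m n)) \<partial>M)"
    by (intro arg_cong2[where f="(*)"] nn_integral_cong) auto
  also have "\<dots> \<le> ennreal (exp (- a)) * 1"
    by (intro mult_left_mono nn_integral_exp_excess assms) auto
  finally show ?thesis by (simp add: emeasure_eq_measure)
qed

section \<open>Uniform almost sure bounds\<close>

text \<open>Union bound over all states of mass \<open>r\<close>, all vertices and all pairs of
  times up to \<open>T * r\<close>, then Borel-Cantelli. Only the law of each single chain enters,
  so the coupling between chains can be arbitrary.\<close>

lemma AE_eventually_excess:
  assumes p: "\<And>i. (\<integral>\<^sup>+\<omega>. ennreal (exp (- real (A 0 \<omega> i))) \<partial>M) \<le> ennreal (exp (- p))"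
    and \<delta>: "\<delta> > 0"
  shows "AE \<omega> in M. \<forall>\<^sub>F r in sequentially. \<forall>x. sum x UNIV = r \<longrightarrow>
    (\<forall>i n m. m \<le> n \<longrightarrow> n \<le> T * r \<longrightarrow> excess E p (\<lambda>k. W x k \<omega>) i m n < \<delta> * real r)"
proof -
  define K where "K = CARD('v)"
  define I where "I r = {x :: 'v \<Rightarrow> nat. sum x UNIV = r} \<times> (UNIV :: 'v set) \<times> (SIGMA n:{..T * r}. {..n})"
    for r
  define B where "B r = (\<lambda>(x, i, n, m). {\<omega>\<in>space M. excess E p (\<lambda>k. W x k \<omega>) i m n \<ge> \<delta> * real r})"
    for r :: nat
  have finI: "finite (I r)" for r
    unfolding I_def by (intro finite_cartesian_product card_states_le finite_SigmaI) auto
  have BM [measurable]: "B r y \<in> sets M" for r y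
    unfolding B_def by (cases y) simp
  have "card (I r) \<le> (r + 1) ^ K * (K * ((T * r + 1) * (T * r + 1)))" for r
  proof -
    have "card (SIGMA n:{..T * r}. {..n}) \<le> card ({..T * r} \<times> {..T * r})"
      by (intro card_mono) auto
    then show ?thesis
      unfolding I_def card_cartesian_product K_def
      by (intro mult_le_mono card_states_le) auto
  qed
  \<comment> \<open>Rounding \<open>T * r + 1\<close> up to \<open>(T + 1) * (r + 1)\<close> leaves
    a constant times a power of \<open>r + 1\<close>, as in
    \<open>summable_poly_exp\<close>.\<close>
  also have "(r + 1) ^ K * (K * ((T * r + 1) * (T * r + 1))) \<le>
      (r + 1) ^ K * (K * (((T + 1) * (r + 1)) * ((T + 1) * (r + 1))))" for r
    by (intro mult_le_mono) auto
  also have "(r + 1) ^ K * (K * (((T + 1) * (r + 1)) * ((T + 1) * (r + 1)))) =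
      K * (T + 1) ^ 2 * (r + 1) ^ (K + 2)" for r
    by (simp add: power_add power2_eq_square algebra_simps)
  finally have cardI: "card (I r) \<le> K * (T + 1) ^ 2 * (r + 1) ^ (K + 2)" for r .
  have bound: "measure M (\<Union>y\<in>I r. B r y) \<le> real (K * (T + 1) ^ 2) * ((real r + 1) ^ (K + 2) * exp (- \<delta> * real r))"
    for r
  proof -
    have "measure M (\<Union>y\<in>I r. B r y) \<le> (\<Sum>y\<in>I r. measure M (B r y))"
      by (intro finite_measure_subadditive_finite finI) auto
    also have "\<dots> \<le> real (card (I r)) * exp (- (\<delta> * real r))"
      using prob_excess[OF p] by (intro sum_bounded_above) (auto simp: I_def B_def)
    also have "\<dots> \<le> real (K * (T + 1) ^ 2 * (r + 1) ^ (K + 2)) * exp (- (\<delta> * real r))"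
      using cardI[of r] by (intro mult_right_mono) (auto simp only: of_nat_le_iff exp_ge_zero)
    also have "real (K * (T + 1) ^ 2 * (r + 1) ^ (K + 2)) =
        real (K * (T + 1) ^ 2) * (real r + 1) ^ (K + 2)"
      by (simp only: of_nat_mult of_nat_power of_nat_add of_nat_1)
    finally show ?thesis by (simp only: mult.assoc mult_minus_left)
  qed
  have sum: "summable (\<lambda>r. measure M (\<Union>y\<in>I r. B r y))"
  proof (rule summable_comparison_test')
    show "summable (\<lambda>r. real (K * (T + 1) ^ 2) * ((real r + 1) ^ (K + 2) * exp (- \<delta> * real r)))"
      by (intro summable_mult summable_poly_exp \<delta>)
  qed (use bound in \<open>simp only: real_norm_def abs_of_nonneg measure_nonneg\<close>)
  have "AE \<omega> in M. \<forall>\<^sub>F r in sequentially. \<omega> \<in> space M - (\<Union>y\<in>I r. B r y)"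
    by (rule borel_cantelli_AE1[OF _ _ sum]) (simp_all add: emeasure_eq_measure finI sets.finite_UN)
  then show ?thesis
  proof eventually_elim
    case (elim \<omega>)
    then show ?case
    proof (eventually_elim, intro allI impI)
      fix r i and x :: "'v \<Rightarrow> nat" and n m
      assume \<omega>: "\<omega> \<in> space M - (\<Union>y\<in>I r. B r y)" and y: "sum x UNIV = r" "m \<le> n" "n \<le> T * r"
      have "(x, i, n, m) \<in> I r" using y by (simp add: I_def)
      with \<omega> have "\<omega> \<in> space M" "\<omega> \<notin> B r (x, i, n, m)" by blast+
      then show "excess E p (\<lambda>k. W x k \<omega>) i m n < \<delta> * real r"
        by (simp add: B_def not_le)
    qed
  qed
qed

text \<open>There are countably many \<open>x\<close> and \<open>n\<close>, so one null set serves
  them all.\<close>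

lemma AE_decrease_le_1: "AE \<omega> in M. \<forall>x n i. W x n \<omega> i \<le> W x (Suc n) \<omega> i + 1"
proof -
  have "AE \<omega> in M. \<forall>i. W x n \<omega> i \<le> W x (Suc n) \<omega> i + 1" for x n
    using W_Suc[of x n]
  proof eventually_elim
    case (elim \<omega>)
    show ?case
    proof
      fix i
      have "success E (N x n \<omega>) i \<le> 1"
        by (rule order_trans[OF success_le]) simp
      with elim[rule_format, of i] show "W x n \<omega> i \<le> W x (Suc n) \<omega> i + 1"
        by linarith
    qed
  qed
  then show ?thesis by (simp add: AE_all_countable)
qed

text \<open>The values \<open>1 / real (Suc j)\<close> suffice for all \<open>\<delta>\<close>,
  which again leaves countably many null sets.\<close>

lemma AE_eventually_excess_all:
  assumes p: "\<And>i. (\<integral>\<^sup>+\<omega>. ennreal (exp (- real (A 0 \<omega> i))) \<partial>M) \<le> ennreal (exp (- p))"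
  shows "AE \<omega> in M. \<forall>\<delta>>0. \<forall>T. \<forall>\<^sub>F r in sequentially. \<forall>x. sum x UNIV = r \<longrightarrow>
    (\<forall>i n m. m \<le> n \<longrightarrow> n \<le> T * r \<longrightarrow> excess E p (\<lambda>k. W x k \<omega>) i m n < \<delta> * real r)"
proof -
  have "AE \<omega> in M. \<forall>j T. \<forall>\<^sub>F r in sequentially. \<forall>x. sum x UNIV = r \<longrightarrow>
    (\<forall>i n m. m \<le> n \<longrightarrow> n \<le> T * r \<longrightarrow> excess E p (\<lambda>k. W x k \<omega>) i m n < 1 / real (Suc j) * real r)"
    unfolding AE_all_countable by (intro allI AE_eventually_excess[OF p]) auto
  then show ?thesis
  proof (eventually_elim, intro allI impI)
    fix \<omega> \<delta> T
    assume \<omega>: "\<forall>j T. \<forall>\<^sub>F r in sequentially. \<forall>x. sum x UNIV = r \<longrightarrow>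
      (\<forall>i n m. m \<le> n \<longrightarrow> n \<le> T * r \<longrightarrow> excess E p (\<lambda>k. W x k \<omega>) i m n < 1 / real (Suc j) * real r)"
      and "\<delta> > (0::real)"
    then obtain j where j: "1 / real (Suc j) < \<delta>" using nat_approx_posE by blast
    have le: "1 / real (Suc j) * real r \<le> \<delta> * real r" for r
      using j by (intro mult_right_mono) auto
    show "\<forall>\<^sub>F r in sequentially. \<forall>x. sum x UNIV = r \<longrightarrow>
      (\<forall>i n m. m \<le> n \<longrightarrow> n \<le> T * r \<longrightarrow> excess E p (\<lambda>k. W x k \<omega>) i m n < \<delta> * real r)"
      using \<omega>[THEN spec, THEN spec, of T j]
    proof (eventually_elim, intro allI impI)
      fix r i and x :: "'v \<Rightarrow> nat" and n m
      assume r: "\<forall>x. sum x UNIV = r \<longrightarrow> (\<forall>i n m. m \<le> n \<longrightarrow> n \<le> T * r \<longrightarrow>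
          excess E p (\<lambda>k. W x k \<omega>) i m n < 1 / real (Suc j) * real r)"
        and "sum x UNIV = r" "m \<le> n" "n \<le> T * r"
      then have "excess E p (\<lambda>k. W x k \<omega>) i m n < 1 / real (Suc j) * real r" by blast
      then show "excess E p (\<lambda>k. W x k \<omega>) i m n < \<delta> * real r"
        using le by (rule less_le_trans)
    qed
  qed
qed

end

section \<open>Passage to the fluid limit\<close>

text \<open>This is \<open>growth\<close> for the path restarted at time \<open>m\<close>; the bound
  on \<open>excess\<close> is its drift hypothesis.\<close>

lemma growth_excess:
  fixes E :: "('v::finite \<times> 'v) set" and w :: "nat \<Rightarrow> 'v \<Rightarrow> nat" and p D r :: real
  assumes E: "sym E" "\<And>i j. (i, j) \<in> E\<^sup>*" and p: "0 < p" "p \<le> 1" and D: "D \<ge> 2"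
    and excess: "\<And>u v j. u \<le> v \<Longrightarrow> v \<le> n \<Longrightarrow> excess E p w j u v \<le> D"
    and dec: "\<And>k i. w k i \<le> w (Suc k) i + 1"
    and start: "real (\<Sum>i\<in>UNIV. w m i) \<ge> r / 2"
    and mn: "m \<le> n" "real n - real m \<le> r / (4 * real CARD('v))"
  shows "real (w n j) \<ge> (p / 4) ^ card E * (real n - real m) - 2 * real (card E) * D"
proof -
  have "real (w ((n - m) + m) j) \<ge> (p / 4) ^ card E * real (n - m) - 2 * real (card E) * D"
  proof (rule growth[OF E p D, where w = "\<lambda>k. w (k + m)" and L = "n - m"])
    fix u v j assume uv: "u \<le> v" "v \<le> n - m"
    have "excess E p w j (u + m) (v + m) \<le> D"
      using uv mn by (intro excess) auto
    then show "real (w (v + m) j) \<ge> real (w (u + m) j) + p * (real v - real u) -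
        2 * (\<Sum>k\<in>{u..<v}. share E (w (k + m)) j) - D"
      by (simp add: excess_def sum.shift_bounds_nat_ivl)
  qed (use dec start mn in \<open>simp_all add: of_nat_diff\<close>)
  then show ?thesis using mn by (simp add: of_nat_diff)
qed

lemma l1_norm_real_vec: "l1_norm (real_vec x) = real (sum x UNIV)"
  by (simp add: l1_norm_def real_vec_def)

lemma scaled_path_nth:
  "scaled_path W \<omega> x t $ i = real (W x (nat \<lceil>real (sum x UNIV) * t\<rceil>) \<omega> i) / real (sum x UNIV)"
  unfolding scaled_path_def l1_norm_real_vec
  by (simp add: real_vec_def divide_inverse_commute del: of_nat_sum)

text \<open>The scaled paths enter the open ball around \<open>z\<close> infinitely often, while the
  masses eventually exceed \<open>R\<close>; some index does both.\<close>

lemma fluid_limit_approximation: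
  assumes z: "fluid_limit W x \<omega> z" and "d > 0"
  obtains n \<mu> e where "real (sum (x n) UNIV) \<ge> R" "time_change \<mu>" "e < d"
    "\<And>s. s \<ge> 0 \<Longrightarrow> \<bar>\<mu> s - s\<bar> \<le> e"
    "\<And>s i. s \<in> {0..t} \<Longrightarrow> \<bar>scaled_path W \<omega> (x n) (\<mu> s) $ i - z s $ i\<bar> \<le> e"
proof -
  have "\<exists>\<^sub>F n in sequentially. scaled_path W \<omega> (x n) \<in> skorokhod_ball z t d"
    using z openin_skorokhod_ball[of z t d] centre_in_skorokhod_ball[OF \<open>d > 0\<close>, of z t]
    by (simp add: fluid_limit_def accumulation_point_def)
  moreover have "\<forall>\<^sub>F n in sequentially. real (sum (x n) UNIV) \<ge> R"
    using z by (simp add: fluid_limit_def l1_norm_real_vec filterlim_at_top del: of_nat_sum)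
  ultimately have "\<exists>\<^sub>F n in sequentially.
      scaled_path W \<omega> (x n) \<in> skorokhod_ball z t d \<and> real (sum (x n) UNIV) \<ge> R"
    by (rule frequently_eventually_frequently)
  then obtain n where n: "scaled_path W \<omega> (x n) \<in> skorokhod_ball z t d" "real (sum (x n) UNIV) \<ge> R"
    using frequently_ex by blast
  then obtain \<mu> e where \<mu>: "time_change \<mu>" "e < d" "\<And>s. s \<ge> 0 \<Longrightarrow> \<bar>\<mu> s - s\<bar> \<le> e"
      and e: "\<And>s. s \<in> {0..t} \<Longrightarrow> dist (scaled_path W \<omega> (x n) (\<mu> s)) (z s) \<le> e"
    unfolding skorokhod_ball_def by blast
  have close: "\<bar>scaled_path W \<omega> (x n) (\<mu> s) $ i - z s $ i\<bar> \<le> e" if "s \<in> {0..t}" for s i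
    using dist_vec_nth_le[of "scaled_path W \<omega> (x n) (\<mu> s)" i "z s"] e[OF that]
    by (simp add: dist_real_def)
  show thesis by (rule that) (fact n(2) \<mu> close)+
qed

text \<open>Apply \<open>growth_excess\<close> to a chain of large mass \<open>r\<close> whose
  scaled path is close to \<open>z\<close>, between the slots \<open>a\<close> and \<open>b\<close>
  that correspond to \<open>s\<close> and \<open>s + h\<close>. All errors together cost less than
  half of \<open>\<gamma> * h\<close>.\<close>

lemma fluid_limit_growth:
  fixes E :: "('v::finite \<times> 'v) set" and z :: "real \<Rightarrow> real ^ 'v"
  assumes E: "sym E" "\<And>i j. (i, j) \<in> E\<^sup>*" and p: "0 < p" "p \<le> 1"
    and excess: "\<forall>\<delta>>0. \<forall>T. \<forall>\<^sub>F r in sequentially. \<forall>x. sum x UNIV = r \<longrightarrow>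
      (\<forall>i n m. m \<le> n \<longrightarrow> n \<le> T * r \<longrightarrow> excess E p (\<lambda>k. W x k \<omega>) i m n < \<delta> * real r)"
    and dec: "\<forall>x n i. W x n \<omega> i \<le> W x (Suc n) \<omega> i + 1"
    and z: "fluid_limit W x \<omega> z"
    and s: "s \<ge> 0" "l1_norm (z s) \<ge> 3 / 4"
    and h: "h > 0" "h \<le> 1 / (8 * real CARD('v))"
  shows "z (s + h) $ i \<ge> (p / 4) ^ card E * h / 2"
proof -
  define K where "K = real CARD('v)"
  define \<gamma> where "\<gamma> = (p / 4) ^ card E"
  define C where "C = 2 * real (card E)"
  \<comment> \<open>The unit of error. The total loss stays below \<open>5 * d\<close>: at most
    \<open>3 * d\<close> from the times, \<open>d\<close> from \<open>excess\<close> and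
    \<open>e < d\<close> from the distance to \<open>z\<close>. The claim allows
    \<open>8 * d\<close>.\<close>
  define d where "d = \<gamma> * h / 16"
  define \<delta> where "\<delta> = d / (C + 1)"
  define t where "t = s + h"
  define T where "T = nat \<lceil>t\<rceil> + 3"
  have K: "K \<ge> 1" by (simp add: K_def Suc_le_eq)
  have \<gamma>: "0 < \<gamma>" "\<gamma> \<le> 1" using p by (auto simp: \<gamma>_def intro: power_le_one)
  have C: "C \<ge> 0" by (simp add: C_def)
  have Kh: "K * h \<le> 1 / 8" using h(2) K by (simp add: K_def field_simps)
  have "1 * h \<le> K * h" using K h(1) by (intro mult_right_mono) auto
  with Kh have h8: "h \<le> 1 / 8" by simp
  have d: "d > 0" "d \<le> h / 16" using \<gamma> h by (auto simp: d_def mult_left_le_one_le)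
  have \<delta>: "\<delta> > 0" using d C by (simp add: \<delta>_def)
  have "\<delta> * (C + 1) = d" using C by (simp add: \<delta>_def)
  then have C\<delta>: "C * \<delta> \<le> d" using \<delta> by (simp add: algebra_simps)
  obtain r0 where r0: "\<forall>r\<ge>r0. \<forall>x. sum x UNIV = r \<longrightarrow>
      (\<forall>i n m. m \<le> n \<longrightarrow> n \<le> T * r \<longrightarrow> excess E p (\<lambda>k. W x k \<omega>) i m n < \<delta> * real r)"
    using excess \<delta> unfolding eventually_sequentially by meson
  \<comment> \<open>The three lower bounds on the mass ensure, in turn, the bound on
    \<open>excess\<close>, the condition \<open>\<delta> * r \<ge> 2\<close> on its error, and a
    rounding error of at most \<open>r * d\<close> in the ceilings.\<close>
  obtain n \<mu> e where R: "real (sum (x n) UNIV) \<ge> max (real r0) (max (2 / \<delta>) (1 / d))"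
    and \<mu>: "time_change \<mu>" and e: "e < d" "\<And>s. s \<ge> 0 \<Longrightarrow> \<bar>\<mu> s - s\<bar> \<le> e"
    and close: "\<And>s i. s \<in> {0..t} \<Longrightarrow> \<bar>scaled_path W \<omega> (x n) (\<mu> s) $ i - z s $ i\<bar> \<le> e"
    by (rule fluid_limit_approximation[OF z d(1),
          where R = "max (real r0) (max (2 / \<delta>) (1 / d))" and t = t]) (rule that)
  define r where "r = real (sum (x n) UNIV)"
  have r: "real r0 \<le> r" "2 / \<delta> \<le> r" "1 / d \<le> r" using R by (auto simp: r_def)
  have "1 / d > 0" using d by simp
  with r have r_pos: "r > 0" by linarith
  have rd: "1 \<le> r * d" using r(3) d(1) by (simp add: field_simps)
  have D: "\<delta> * r \<ge> 2" using r(2) \<delta> by (simp add: field_simps)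
  define a where "a = nat \<lceil>r * \<mu> s\<rceil>"
  define b where "b = nat \<lceil>r * \<mu> t\<rceil>"
  have st: "0 \<le> s" "s < t" "s \<in> {0..t}" "t \<in> {0..t}" using s h by (auto simp: t_def)
  have \<mu>_mono: "strict_mono_on {0..} \<mu>" and \<mu>_image: "\<mu> ` {0..} = {0..}"
    using \<mu> by (simp_all add: time_change_def)
  have mono: "\<mu> s < \<mu> t"
    by (rule strict_mono_onD[OF \<mu>_mono]) (use st in auto)
  have "\<mu> s \<in> \<mu> ` {0..}" using st(1) by simp
  then have "\<mu> s \<ge> 0" by (simp add: \<mu>_image)
  then have nn: "0 \<le> r * \<mu> s" "0 \<le> r * \<mu> t" "r * \<mu> s \<le> r * \<mu> t"
    using mono r_pos by simp_all
  have a: "r * \<mu> s \<le> real a" "real a \<le> r * \<mu> s + 1"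
    using nn unfolding a_def by linarith+
  have b: "r * \<mu> t \<le> real b" "real b \<le> r * \<mu> t + 1"
    using nn unfolding b_def by linarith+
  have ab: "a \<le> b" using nn unfolding a_def b_def by (intro nat_mono ceiling_mono)
  have e_h: "e \<le> h / 16" using e(1) d(2) by linarith
  have gap: "h - 2 * e \<le> \<mu> t - \<mu> s" "\<mu> t - \<mu> s \<le> h + 2 * e"
    using e(2)[of s] e(2)[of t] st by (auto simp: t_def abs_le_iff)
  have "r * (h - 2 * e) \<le> r * (\<mu> t - \<mu> s)" "r * (\<mu> t - \<mu> s) \<le> r * (h + 2 * e)"
    using gap r_pos by simp_all
  then have rgap: "r * h - 2 * (r * e) \<le> r * \<mu> t - r * \<mu> s"
      "r * \<mu> t - r * \<mu> s \<le> r * h + 2 * (r * e)"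
    by (simp_all add: algebra_simps)
  have "r * d \<le> r * (h / 16)" using d(2) r_pos by simp
  then have rd_h: "r * d \<le> r * h / 16" by simp
  have re_d: "r * e \<le> r * d" using e(1) r_pos by simp
  have rh: "r * h > 0" using h(1) r_pos by simp
  have length: "real b - real a \<le> r / (4 * real CARD('v))"
  proof -
    have "real b - real a \<le> 2 * (r * h)"
      using a b rgap rd rd_h re_d rh by linarith
    also have "\<dots> = 2 * (r / K) * (K * h)" using K by simp
    also have "\<dots> \<le> 2 * (r / K) * (1 / 8)" using Kh K r_pos by (intro mult_left_mono) auto
    finally show ?thesis by (simp add: K_def)
  qed
  have "real b \<le> real (T * sum (x n) UNIV)"
  proof -
    have "\<mu> t \<le> t + 1" using e(2)[of t] e_h h8 st by (auto simp: abs_le_iff)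
    then have "r * \<mu> t \<le> r * (t + 1)" using r_pos by simp
    moreover have "r * d \<le> r * 1" using d(2) h8 r_pos by simp
    moreover have "r * (t + 2) = r * (t + 1) + r * 1" by (simp add: algebra_simps)
    ultimately have "real b \<le> r * (t + 2)" using b rd by linarith
    also have "\<dots> \<le> r * real T" using r_pos unfolding T_def by (intro mult_left_mono) linarith+
    finally show ?thesis by (simp add: r_def mult.commute)
  qed
  then have bT: "b \<le> T * sum (x n) UNIV" by (simp only: of_nat_le_iff)
  have path: "scaled_path W \<omega> (x n) (\<mu> s) $ j = real (W (x n) a \<omega> j) / r"
    "scaled_path W \<omega> (x n) (\<mu> t) $ j = real (W (x n) b \<omega> j) / r" for j
    by (simp_all only: scaled_path_nth a_def b_def r_def)
  \<comment> \<open>Passing from \<open>z s\<close> to the chain loses at most \<open>K * e\<close>,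
    which is at most \<open>1 / 128\<close>; the mass therefore stays above
    \<open>r / 2\<close>.\<close>
  have start: "real (\<Sum>j\<in>UNIV. W (x n) a \<omega> j) \<ge> r / 2"
  proof -
    have "l1_norm (z s) \<le> (\<Sum>j\<in>(UNIV :: 'v set). real (W (x n) a \<omega> j) / r + e)"
      unfolding l1_norm_def
    proof (rule sum_mono)
      fix j
      have "real (W (x n) a \<omega> j) / r \<ge> 0" using r_pos by simp
      then show "\<bar>z s $ j\<bar> \<le> real (W (x n) a \<omega> j) / r + e"
        using close[OF st(3), of j] unfolding path by linarith
    qed
    also have "\<dots> = real (\<Sum>j\<in>UNIV. W (x n) a \<omega> j) / r + K * e"
      by (simp add: sum.distrib K_def flip: sum_divide_distrib)
    finally have "3 / 4 \<le> real (\<Sum>j\<in>UNIV. W (x n) a \<omega> j) / r + K * e" using s by linarith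
    moreover have "K * e \<le> K * (h / 16)" using e_h K by (intro mult_left_mono) auto
    ultimately have "1 / 2 \<le> real (\<Sum>j\<in>UNIV. W (x n) a \<omega> j) / r" using Kh by simp
    then show ?thesis using r_pos by (simp add: field_simps)
  qed
  have "real (W (x n) b \<omega> i) \<ge> \<gamma> * (real b - real a) - C * (\<delta> * r)"
    unfolding \<gamma>_def C_def
  proof (rule growth_excess[where w = "\<lambda>k. W (x n) k \<omega>" and m = a and r = r])
    show "r / 2 \<le> real (\<Sum>j\<in>UNIV. W (x n) a \<omega> j)" by (rule start)
    fix u v j assume "u \<le> v" "v \<le> b"
    then show "excess E p (\<lambda>k. W (x n) k \<omega>) j u v \<le> \<delta> * r"
      using r0[rule_format, of "sum (x n) UNIV" "x n" u v j] r(1) bT by (simp add: r_def del: of_nat_sum)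
  next
    show "W (x n) k \<omega> j \<le> W (x n) (Suc k) \<omega> j + 1" for k j
      using dec by blast
  qed (fact E p D ab length)+
  \<comment> \<open>The time change shortens the interval by at most \<open>2 * e\<close>, the
    ceilings by at most \<open>1 / r\<close>, and both \<open>e\<close> and \<open>1 / r\<close> are
    at most \<open>d\<close>.\<close>
  moreover have "\<gamma> * (real b - real a) \<ge> \<gamma> * (r * (h - 3 * d))"
  proof (intro mult_left_mono)
    have "r * (h - 3 * d) = r * h - 3 * (r * d)" by (simp add: algebra_simps)
    then show "real b - real a \<ge> r * (h - 3 * d)"
      using a b rgap rd re_d by linarith
  qed (use \<gamma> in auto)
  moreover have "C * (\<delta> * r) \<le> d * r"
    using C\<delta> r_pos by (simp flip: mult.assoc)
  ultimately have "real (W (x n) b \<omega> i) \<ge> (\<gamma> * (h - 3 * d) - d) * r"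
    by (simp add: algebra_simps)
  then have "scaled_path W \<omega> (x n) (\<mu> t) $ i \<ge> \<gamma> * (h - 3 * d) - d"
    unfolding path using r_pos by (simp add: field_simps)
  then have "z t $ i \<ge> \<gamma> * (h - 3 * d) - d - e"
    using close[OF st(4), of i] by linarith
  moreover have "\<gamma> * d \<le> d" using \<gamma> d by (simp add: mult_left_le_one_le)
  then have "\<gamma> * (h - 3 * d) \<ge> \<gamma> * h - 3 * d" by (simp add: algebra_simps)
  moreover have "16 * d = \<gamma> * h" by (simp add: d_def)
  ultimately have "z t $ i \<ge> \<gamma> * h / 2" using e(1) d(1) by linarith
  then show ?thesis by (simp add: t_def \<gamma>_def)
qed

theorem theorem4:
  fixes M :: "'w measure"
    and E :: "('v::finite \<times> 'v) set"
    and lam :: "'v \<Rightarrow> real"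
    and A :: "nat \<Rightarrow> 'w \<Rightarrow> ('v \<Rightarrow> nat)"
    and W N :: "('v \<Rightarrow> nat) \<Rightarrow> nat \<Rightarrow> 'w \<Rightarrow> ('v \<Rightarrow> nat)"
    and lam_min c :: real
  assumes "random_access_network M E lam A W N"
    and "lam_min = (MIN i. lam i)"
    and "lam_min < 1"
    and "c = 1 / (real CARD('v) * (1 - lam_min))"
  shows "\<exists>b>0. \<exists>\<epsilon>\<^sub>0>0. \<forall>x. AE \<omega> in M. \<forall>z. fluid_limit W x \<omega> z \<longrightarrow>
           (\<forall>\<epsilon>\<in>{0<..<\<epsilon>\<^sub>0}. \<forall>t\<ge>c * \<epsilon>. ereal t < hitting_time z (1 - \<epsilon>) \<longrightarrow>
              (MIN i. z t $ i) \<ge> b * \<epsilon>)"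
proof -
  interpret random_access_network M E lam A W N by (rule assms(1))
  have c: "c > 0" using assms(3) by (simp add: assms(4))
  obtain p where p: "0 < p" "p \<le> 1"
    and rate: "\<And>i. (\<integral>\<^sup>+\<omega>. ennreal (exp (- real (A 0 \<omega> i))) \<partial>M) \<le> ennreal (exp (- p))"
    using arrival_rate by blast
  \<comment> \<open>The bound of \<open>fluid_limit_growth\<close> with
    \<open>h = c * \<epsilon>\<close>, divided by \<open>\<epsilon>\<close>.\<close>
  define b where "b = (p / 4) ^ card E * c / 2"
  \<comment> \<open>The first entry gives \<open>1 - \<epsilon> \<ge> 3 / 4\<close>, the second
    makes \<open>c * \<epsilon>\<close> an admissible time step \<open>h\<close>.\<close>
  define \<epsilon>\<^sub>0 where "\<epsilon>\<^sub>0 = min (1 / 4) (1 / (8 * real CARD('v) * c))"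
  have "b > 0" "\<epsilon>\<^sub>0 > 0" using p c by (simp_all add: b_def \<epsilon>\<^sub>0_def)
  moreover have "AE \<omega> in M. \<forall>z. fluid_limit W x \<omega> z \<longrightarrow>
      (\<forall>\<epsilon>\<in>{0<..<\<epsilon>\<^sub>0}. \<forall>t\<ge>c * \<epsilon>. ereal t < hitting_time z (1 - \<epsilon>) \<longrightarrow> (MIN i. z t $ i) \<ge> b * \<epsilon>)" for x
    using AE_eventually_excess_all[OF rate] AE_decrease_le_1
  proof (eventually_elim, intro allI ballI impI)
    fix \<omega> z \<epsilon> t
    assume path: "\<forall>\<delta>>0. \<forall>T. \<forall>\<^sub>F r in sequentially. \<forall>x. sum x UNIV = r \<longrightarrow>
        (\<forall>i n m. m \<le> n \<longrightarrow> n \<le> T * r \<longrightarrow> excess E p (\<lambda>k. W x k \<omega>) i m n < \<delta> * real r)"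
        "\<forall>x n i. W x n \<omega> i \<le> W x (Suc n) \<omega> i + 1"
      and z: "fluid_limit W x \<omega> z"
      and \<epsilon>: "\<epsilon> \<in> {0<..<\<epsilon>\<^sub>0}" and t: "c * \<epsilon> \<le> t" "ereal t < hitting_time z (1 - \<epsilon>)"
    have ce: "0 < c * \<epsilon>" "c * \<epsilon> \<le> 1 / (8 * real CARD('v))"
      using \<epsilon> c by (auto simp: \<epsilon>\<^sub>0_def field_simps)
    \<comment> \<open>The time \<open>t - c * \<epsilon>\<close> is nonnegative and precedes the
      hitting time, so the mass there is still at least \<open>1 - \<epsilon>\<close>.\<close>
    have "\<not> l1_norm (z (t - c * \<epsilon>)) < 1 - \<epsilon>"
    proof
      assume "l1_norm (z (t - c * \<epsilon>)) < 1 - \<epsilon>"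
      then have "hitting_time z (1 - \<epsilon>) \<le> ereal (t - c * \<epsilon>)"
        unfolding hitting_time_def using t(1) by (intro INF_lower) auto
      also have "\<dots> \<le> ereal t" using ce by simp
      finally show False using t(2) by simp
    qed
    then have "l1_norm (z (t - c * \<epsilon>)) \<ge> 3 / 4" using \<epsilon> by (auto simp: \<epsilon>\<^sub>0_def)
    then have "z (t - c * \<epsilon> + c * \<epsilon>) $ i \<ge> (p / 4) ^ card E * (c * \<epsilon>) / 2" for i
      using t(1) by (intro fluid_limit_growth[OF undirected connected_graph p path z _ _ ce]) auto
    then show "b * \<epsilon> \<le> (MIN i. z t $ i)"
      by (intro Min.boundedI) (auto simp: b_def mult.assoc)
  qed
  ultimately show ?thesis by blast
qed

end
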